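(* Let $I$ be a set of unary connectives with $\mathcal{L}\cap I=\emptyset$. Then (1) $\mathbf{Ł}(I)$ is algebraizable in the sense of Blok and Pigozzi with sole defining equation $\varphi\approx 1$ and sole equivalence formula $\varphi\leftrightarrow\psi$, and consequently so are $\mathbf{S4Ł}(I)$, $\mathbf{S4Ł}$ and $\mathbf{S4_tŁ}$; (2) the equivalent variety semantics of $\mathbf{Ł}(I)$, $\mathbf{S4Ł}(I)$, $\mathbf{S4Ł}$ and $\mathbf{S4_tŁ}$ are, respectively, $\mathsf{MV}(I)$, $\mathsf{S4MV}(I)$, $\mathsf{S4MV}$ and $\mathsf{S4_tMV}$.
   Context: $\mathcal{L}$ has binary connectives $\wedge,\vee,\cdot,\to$ and constants $0,1$; $\mathcal{L}(I)=\mathcal{L}\cup I$. $\varphi\leftrightarrow\psi$ abbreviates $(\varphi\to\psi)\wedge(\psi\to\varphi)$, $\neg\varphi$ abbreviates $\varphi\to0$. Axiom schemes: (A1) $\varphi\to\varphi$; (A2) $(\varphi\to\psi)\to((\psi\to\chi)\to(\varphi\to\chi))$; (A3) $(\varphi\cdot\psi)\to(\psi\cdot\varphi)$; (A4) $(\varphi\cdot\psi)\to\psi$; (A5) $(\varphi\to(\psi\to\chi))\to((\varphi\cdot\psi)\to\chi)$; (A6) $((\varphi\cdot\psi)\to\chi)\to(\varphi\to(\psi\to\chi))$; (A7) $(\varphi\cdot(\varphi\to\psi))\to(\varphi\wedge\psi)$; (A8) $(\varphi\wedge\psi)\to(\varphi\cdot(\varphi\to\psi))$; (A9) $(\varphi\wedge\psi)\to(\psi\wedge\varphi)$;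 (A10) $\varphi\to(\varphi\vee\psi)$; (A11) $\psi\to(\varphi\vee\psi)$; (A12) $((\varphi\to\psi)\wedge(\chi\to\psi))\to((\varphi\vee\chi)\to\psi)$; (A13) $0\to\varphi$; (A14) $(\varphi\to\psi)\vee(\psi\to\varphi)$; (A15) $\neg\neg\varphi\leftrightarrow\varphi$; for unary $\Box$: (K$_\Box$) $\Box(\varphi\to\psi)\to(\Box\varphi\to\Box\psi)$; (P$_\Box$) $\Box(\varphi\cdot\psi)\leftrightarrow\Box\varphi\cdot\Box\psi$; (M$_\Box$) $\Box(\varphi\wedge\psi)\leftrightarrow\Box\varphi\wedge\Box\psi$; (1$_\Box$) $\Box1\leftrightarrow1$; (0$_\Box$) $\Box0\leftrightarrow0$; (T$_\Box$) $\Box\varphi\to\varphi$; (4$_\Box$) $\Box\varphi\to\Box\Box\varphi$; (GP) $\varphi\to G\neg H\neg\varphi$; (HF) $\varphi\to H\neg G\neg\varphi$. Rules: (MP) $\varphi,\varphi\to\psi\vdash\psi$; ($\Box$-Nec) $\varphi\vdash\Box\varphi$. $\mathbf{Ł}(I)$: language $\mathcal{L}(I)$, axioms (A1)–(A15) and (K$_\Box$),(P$_\Box$),(M$_\Box$),(1$_\Box$),(0$_\Box$) for all $\Box\in I$, rules (MP) and ($\Box$-Nec) for all $\Box\in I$. $\mathbf{S4Ł}(I)$ adds (T$_\Box$),(4$_\Box$) for all $\Box\in I$; $\mathbf{S4Ł}=\mathbf{S4Ł}(\{\Box\})$; $\mathbf{S4_tŁ}$ is $\mathbf{S4Ł}(\{G,H\})$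 plus (GP),(HF). An MV(I)-algebra is an MV-algebra $(A,\wedge,\vee,\cdot,\to,0,1)$ with, for each $\Box\in I$, a unary operation $\Box$ that is a $\{\wedge,\cdot,0,1\}$-endomorphism of the MV-algebra. It is an S4MV(I)-algebra if moreover each $\Box\in I$ is an interior operator; an S4MV-algebra is an S4MV(I)-algebra with $I=\{\Box\}$; an S4$_t$MV-algebra is an S4MV($\{G,H\}$)-algebra in which $P(x)=\neg H(\neg x)$ satisfies $x\le G(y)\iff P(x)\le y$. $\mathsf{MV}(I),\mathsf{S4MV}(I),\mathsf{S4MV},\mathsf{S4_tMV}$ denote these classes (they are varieties).
   Formalization: The formula 1 is added as an axiom to all four logics, since (A1)–(A15) with the modal schemes do not prove 1, which the defining equation φ≈1 requires; algebras have carriers inside an arbitrary universe large enough to contain a copy of the formulas of L(I). *)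

theory Defs
  imports Main
begin

section \<open>Formulas\<close>

text \<open>Modal connectives are tagged by the constructor \<open>Box\<close>, so they are disjoint from
  the propositional ones. A set \<open>I\<close> of connectives is a (possibly empty) subset of the
  type of connective symbols; \<open>conns\<close> collects the symbols occurring in a formula.\<close>

datatype (conns: 'i) fm =
    Var nat
  | Zero
  | One
  | And "'i fm" "'i fm" (infixr "\<^bold>\<and>" 75)
  | Or "'i fm" "'i fm" (infixr "\<^bold>\<or>" 74)
  | Dot "'i fm" "'i fm" (infixr "\<^bold>\<cdot>" 76)
  | Imp "'i fm" "'i fm" (infixr "\<^bold>\<rightarrow>" 73)
  | Box 'i "'i fm"

abbreviation Neg :: "'i fm \<Rightarrow> 'i fm" ("\<^bold>\<not> _" [80] 80) where
  "\<^bold>\<not> \<phi> \<equiv> \<phi> \<^bold>\<rightarrow> Zero"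

abbreviation Iff :: "'i fm \<Rightarrow> 'i fm \<Rightarrow> 'i fm" (infix "\<^bold>\<leftrightarrow>" 72) where
  "\<phi> \<^bold>\<leftrightarrow> \<psi> \<equiv> (\<phi> \<^bold>\<rightarrow> \<psi>) \<^bold>\<and> (\<psi> \<^bold>\<rightarrow> \<phi>)"

definition Fm :: "'i set \<Rightarrow> 'i fm set" where
  "Fm I = {\<phi>. conns \<phi> \<subseteq> I}"

primrec vars :: "'i fm \<Rightarrow> nat set" where
  "vars (Var n) = {n}"
| "vars Zero = {}"
| "vars One = {}"
| "vars (\<phi> \<^bold>\<and> \<psi>) = vars \<phi> \<union> vars \<psi>"
| "vars (\<phi> \<^bold>\<or> \<psi>) = vars \<phi> \<union> vars \<psi>"
| "vars (\<phi> \<^bold>\<cdot> \<psi>) = vars \<phi> \<union> vars \<psi>"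
| "vars (\<phi> \<^bold>\<rightarrow> \<psi>) = vars \<phi> \<union> vars \<psi>"
| "vars (Box i \<phi>) = vars \<phi>"

primrec subst :: "(nat \<Rightarrow> 'i fm) \<Rightarrow> 'i fm \<Rightarrow> 'i fm" where
  "subst \<sigma> (Var n) = \<sigma> n"
| "subst \<sigma> Zero = Zero"
| "subst \<sigma> One = One"
| "subst \<sigma> (\<phi> \<^bold>\<and> \<psi>) = subst \<sigma> \<phi> \<^bold>\<and> subst \<sigma> \<psi>"
| "subst \<sigma> (\<phi> \<^bold>\<or> \<psi>) = subst \<sigma> \<phi> \<^bold>\<or> subst \<sigma> \<psi>"
| "subst \<sigma> (\<phi> \<^bold>\<cdot> \<psi>) = subst \<sigma> \<phi> \<^bold>\<cdot> subst \<sigma> \<psi>"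
| "subst \<sigma> (\<phi> \<^bold>\<rightarrow> \<psi>) = (subst \<sigma> \<phi> \<^bold>\<rightarrow> subst \<sigma> \<psi>)"
| "subst \<sigma> (Box i \<phi>) = Box i (subst \<sigma> \<phi>)"


section \<open>The logics\<close>

inductive_set L_axioms :: "'i set \<Rightarrow> 'i fm set" for I :: "'i set" where
  A1: "\<phi> \<in> Fm I \<Longrightarrow> \<phi> \<^bold>\<rightarrow> \<phi> \<in> L_axioms I"
| A2: "\<lbrakk>\<phi> \<in> Fm I; \<psi> \<in> Fm I; \<chi> \<in> Fm I\<rbrakk> \<Longrightarrow>
    (\<phi> \<^bold>\<rightarrow> \<psi>) \<^bold>\<rightarrow> ((\<psi> \<^bold>\<rightarrow> \<chi>) \<^bold>\<rightarrow> (\<phi> \<^bold>\<rightarrow> \<chi>)) \<in> L_axioms I"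
| A3: "\<lbrakk>\<phi> \<in> Fm I; \<psi> \<in> Fm I\<rbrakk> \<Longrightarrow> (\<phi> \<^bold>\<cdot> \<psi>) \<^bold>\<rightarrow> (\<psi> \<^bold>\<cdot> \<phi>) \<in> L_axioms I"
| A4: "\<lbrakk>\<phi> \<in> Fm I; \<psi> \<in> Fm I\<rbrakk> \<Longrightarrow> (\<phi> \<^bold>\<cdot> \<psi>) \<^bold>\<rightarrow> \<psi> \<in> L_axioms I"
| A5: "\<lbrakk>\<phi> \<in> Fm I; \<psi> \<in> Fm I; \<chi> \<in> Fm I\<rbrakk> \<Longrightarrow>
    (\<phi> \<^bold>\<rightarrow> (\<psi> \<^bold>\<rightarrow> \<chi>)) \<^bold>\<rightarrow> ((\<phi> \<^bold>\<cdot> \<psi>) \<^bold>\<rightarrow> \<chi>) \<in> L_axioms I"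
| A6: "\<lbrakk>\<phi> \<in> Fm I; \<psi> \<in> Fm I; \<chi> \<in> Fm I\<rbrakk> \<Longrightarrow>
    ((\<phi> \<^bold>\<cdot> \<psi>) \<^bold>\<rightarrow> \<chi>) \<^bold>\<rightarrow> (\<phi> \<^bold>\<rightarrow> (\<psi> \<^bold>\<rightarrow> \<chi>)) \<in> L_axioms I"
| A7: "\<lbrakk>\<phi> \<in> Fm I; \<psi> \<in> Fm I\<rbrakk> \<Longrightarrow> (\<phi> \<^bold>\<cdot> (\<phi> \<^bold>\<rightarrow> \<psi>)) \<^bold>\<rightarrow> (\<phi> \<^bold>\<and> \<psi>) \<in> L_axioms I"
| A8: "\<lbrakk>\<phi> \<in> Fm I; \<psi> \<in> Fm I\<rbrakk> \<Longrightarrow> (\<phi> \<^bold>\<and> \<psi>) \<^bold>\<rightarrow> (\<phi> \<^bold>\<cdot> (\<phi> \<^bold>\<rightarrow> \<psi>)) \<in> L_axioms I"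
| A9: "\<lbrakk>\<phi> \<in> Fm I; \<psi> \<in> Fm I\<rbrakk> \<Longrightarrow> (\<phi> \<^bold>\<and> \<psi>) \<^bold>\<rightarrow> (\<psi> \<^bold>\<and> \<phi>) \<in> L_axioms I"
| A10: "\<lbrakk>\<phi> \<in> Fm I; \<psi> \<in> Fm I\<rbrakk> \<Longrightarrow> \<phi> \<^bold>\<rightarrow> (\<phi> \<^bold>\<or> \<psi>) \<in> L_axioms I"
| A11: "\<lbrakk>\<phi> \<in> Fm I; \<psi> \<in> Fm I\<rbrakk> \<Longrightarrow> \<psi> \<^bold>\<rightarrow> (\<phi> \<^bold>\<or> \<psi>) \<in> L_axioms I"
| A12: "\<lbrakk>\<phi> \<in> Fm I; \<psi> \<in> Fm I; \<chi> \<in> Fm I\<rbrakk> \<Longrightarrow>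
    ((\<phi> \<^bold>\<rightarrow> \<psi>) \<^bold>\<and> (\<chi> \<^bold>\<rightarrow> \<psi>)) \<^bold>\<rightarrow> ((\<phi> \<^bold>\<or> \<chi>) \<^bold>\<rightarrow> \<psi>) \<in> L_axioms I"
| A13: "\<phi> \<in> Fm I \<Longrightarrow> Zero \<^bold>\<rightarrow> \<phi> \<in> L_axioms I"
| A14: "\<lbrakk>\<phi> \<in> Fm I; \<psi> \<in> Fm I\<rbrakk> \<Longrightarrow> (\<phi> \<^bold>\<rightarrow> \<psi>) \<^bold>\<or> (\<psi> \<^bold>\<rightarrow> \<phi>) \<in> L_axioms I"
| A15: "\<phi> \<in> Fm I \<Longrightarrow> \<^bold>\<not> \<^bold>\<not> \<phi> \<^bold>\<leftrightarrow> \<phi> \<in> L_axioms I"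
| Box_K: "\<lbrakk>i \<in> I; \<phi> \<in> Fm I; \<psi> \<in> Fm I\<rbrakk> \<Longrightarrow>
    Box i (\<phi> \<^bold>\<rightarrow> \<psi>) \<^bold>\<rightarrow> (Box i \<phi> \<^bold>\<rightarrow> Box i \<psi>) \<in> L_axioms I"
| Box_P: "\<lbrakk>i \<in> I; \<phi> \<in> Fm I; \<psi> \<in> Fm I\<rbrakk> \<Longrightarrow>
    Box i (\<phi> \<^bold>\<cdot> \<psi>) \<^bold>\<leftrightarrow> Box i \<phi> \<^bold>\<cdot> Box i \<psi> \<in> L_axioms I"
| Box_M: "\<lbrakk>i \<in> I; \<phi> \<in> Fm I; \<psi> \<in> Fm I\<rbrakk> \<Longrightarrow>
    Box i (\<phi> \<^bold>\<and> \<psi>) \<^bold>\<leftrightarrow> Box i \<phi> \<^bold>\<and> Box i \<psi> \<in> L_axioms I"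
| Box_1: "i \<in> I \<Longrightarrow> Box i One \<^bold>\<leftrightarrow> One \<in> L_axioms I"
| Box_0: "i \<in> I \<Longrightarrow> Box i Zero \<^bold>\<leftrightarrow> Zero \<in> L_axioms I"

definition S4L_axioms :: "'i set \<Rightarrow> 'i fm set" where
  "S4L_axioms I = L_axioms I
     \<union> {Box i \<phi> \<^bold>\<rightarrow> \<phi> | i \<phi>. i \<in> I \<and> \<phi> \<in> Fm I}
     \<union> {Box i \<phi> \<^bold>\<rightarrow> Box i (Box i \<phi>) | i \<phi>. i \<in> I \<and> \<phi> \<in> Fm I}"

datatype s4_conn = Nec
datatype tense_conn = G | H

definition S4tL_axioms :: "tense_conn fm set" where
  "S4tL_axioms = S4L_axioms {G, H}
     \<union> {\<phi> \<^bold>\<rightarrow> Box G (\<^bold>\<not> Box H (\<^bold>\<not> \<phi>)) | \<phi>. \<phi> \<in> Fm {G, H}}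
     \<union> {\<phi> \<^bold>\<rightarrow> Box H (\<^bold>\<not> Box G (\<^bold>\<not> \<phi>)) | \<phi>. \<phi> \<in> Fm {G, H}}"

inductive derives :: "'i set \<Rightarrow> 'i fm set \<Rightarrow> 'i fm set \<Rightarrow> 'i fm \<Rightarrow> bool"
  for I :: "'i set" and Ax \<Gamma> :: "'i fm set" where
  Ax: "\<phi> \<in> Ax \<Longrightarrow> derives I Ax \<Gamma> \<phi>"
| Hyp: "\<phi> \<in> \<Gamma> \<Longrightarrow> derives I Ax \<Gamma> \<phi>"
| MP: "derives I Ax \<Gamma> \<phi> \<Longrightarrow> derives I Ax \<Gamma> (\<phi> \<^bold>\<rightarrow> \<psi>) \<Longrightarrow> derives I Ax \<Gamma> \<psi>"
| Nec: "derives I Ax \<Gamma> \<phi> \<Longrightarrow> i \<in> I \<Longrightarrow> derives I Ax \<Gamma> (Box i \<phi>)"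

text \<open>The schemes above do not determine the constant \<open>One\<close>: they remain valid in the
  two-element algebra with identity modalities when \<open>One\<close> is read as falsum, so \<open>One\<close>
  is not a theorem (see the lemmas below). Since \<open>One \<approx> One\<close> holds in every algebra,
  \<open>One\<close> must be a theorem of any logic with defining equation \<open>\<phi> \<approx> 1\<close>. The logics
  therefore have the formula \<open>One\<close> as an additional axiom, which is tacit in the usual
  convention that \<open>1\<close> denotes truth.\<close>

definition L :: "'i set \<Rightarrow> 'i fm set \<Rightarrow> 'i fm \<Rightarrow> bool" where
  "L I = derives I (insert One (L_axioms I))"

definition S4L_I :: "'i set \<Rightarrow> 'i fm set \<Rightarrow> 'i fm \<Rightarrow> bool" where
  "S4L_I I = derives I (insert One (S4L_axioms I))"

definition S4L :: "s4_conn fm set \<Rightarrow> s4_conn fm \<Rightarrow> bool" where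
  "S4L = S4L_I {Nec}"

definition S4tL :: "tense_conn fm set \<Rightarrow> tense_conn fm \<Rightarrow> bool" where
  "S4tL = derives {G, H} (insert One S4tL_axioms)"

primrec falsum_val :: "'i fm \<Rightarrow> bool" where
  "falsum_val (Var n) = True"
| "falsum_val Zero = False"
| "falsum_val One = False"
| "falsum_val (\<phi> \<^bold>\<and> \<psi>) = (falsum_val \<phi> \<and> falsum_val \<psi>)"
| "falsum_val (\<phi> \<^bold>\<or> \<psi>) = (falsum_val \<phi> \<or> falsum_val \<psi>)"
| "falsum_val (\<phi> \<^bold>\<cdot> \<psi>) = (falsum_val \<phi> \<and> falsum_val \<psi>)"
| "falsum_val (\<phi> \<^bold>\<rightarrow> \<psi>) = (falsum_val \<phi> \<longrightarrow> falsum_val \<psi>)"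
| "falsum_val (Box i \<phi>) = falsum_val \<phi>"

lemma falsum_val_derives:
  assumes "derives I Ax {} \<phi>" and "\<And>\<alpha>. \<alpha> \<in> Ax \<Longrightarrow> falsum_val \<alpha>"
  shows "falsum_val \<phi>"
  using assms by (induction rule: derives.induct) auto

lemma falsum_val_L_axioms: "\<alpha> \<in> L_axioms I \<Longrightarrow> falsum_val \<alpha>"
  by (induction rule: L_axioms.induct) auto

lemma falsum_val_S4L_axioms: "\<alpha> \<in> S4L_axioms I \<Longrightarrow> falsum_val \<alpha>"
  by (auto simp: S4L_axioms_def falsum_val_L_axioms)

lemma falsum_val_S4tL_axioms: "\<alpha> \<in> S4tL_axioms \<Longrightarrow> falsum_val \<alpha>"
  by (auto simp: S4tL_axioms_def falsum_val_S4L_axioms)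

lemma One_not_derivable:
  shows "\<not> derives I (L_axioms I) {} One"
    and "\<not> derives I (S4L_axioms I) {} One"
    and "\<not> derives {G, H} S4tL_axioms {} One"
  using falsum_val_derives[of _ _ One] falsum_val_L_axioms falsum_val_S4L_axioms
    falsum_val_S4tL_axioms by fastforce+


section \<open>Algebras\<close>

record ('i, 'a) alg =
  car :: "'a set"
  meet :: "'a \<Rightarrow> 'a \<Rightarrow> 'a"
  join :: "'a \<Rightarrow> 'a \<Rightarrow> 'a"
  mul :: "'a \<Rightarrow> 'a \<Rightarrow> 'a"
  imp :: "'a \<Rightarrow> 'a \<Rightarrow> 'a"
  bot :: 'a
  top :: 'a
  box :: "'i \<Rightarrow> 'a \<Rightarrow> 'a"

hide_const (open) bot top

definition lang_algebra :: "'i set \<Rightarrow> ('i, 'a) alg \<Rightarrow> bool" where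
  "lang_algebra I A \<longleftrightarrow>
     alg.bot A \<in> car A \<and> alg.top A \<in> car A \<and>
     (\<forall>x\<in>car A. \<forall>y\<in>car A. meet A x y \<in> car A \<and> join A x y \<in> car A \<and>
        mul A x y \<in> car A \<and> imp A x y \<in> car A) \<and>
     (\<forall>i\<in>I. \<forall>x\<in>car A. box A i x \<in> car A)"

definition le :: "('i, 'a) alg \<Rightarrow> 'a \<Rightarrow> 'a \<Rightarrow> bool" where
  "le A x y \<longleftrightarrow> meet A x y = x"

definition neg :: "('i, 'a) alg \<Rightarrow> 'a \<Rightarrow> 'a" where
  "neg A x = imp A x (alg.bot A)"

text \<open>In the signature at hand, MV-algebras are the bounded commutative integral residuated
  lattices that are divisible, prelinear and involutive.\<close>

definition mv_algebra :: "('i, 'a) alg \<Rightarrow> bool" where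
  "mv_algebra A \<longleftrightarrow> lang_algebra {} A \<and>
     (\<forall>x\<in>car A. \<forall>y\<in>car A. meet A x y = meet A y x) \<and>
     (\<forall>x\<in>car A. \<forall>y\<in>car A. join A x y = join A y x) \<and>
     (\<forall>x\<in>car A. \<forall>y\<in>car A. \<forall>z\<in>car A. meet A (meet A x y) z = meet A x (meet A y z)) \<and>
     (\<forall>x\<in>car A. \<forall>y\<in>car A. \<forall>z\<in>car A. join A (join A x y) z = join A x (join A y z)) \<and>
     (\<forall>x\<in>car A. \<forall>y\<in>car A. meet A x (join A x y) = x) \<and>
     (\<forall>x\<in>car A. \<forall>y\<in>car A. join A x (meet A x y) = x) \<and>
     (\<forall>x\<in>car A. le A (alg.bot A) x \<and> le A x (alg.top A)) \<and>
     (\<forall>x\<in>car A. \<forall>y\<in>car A. mul A x y = mul A y x) \<and>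
     (\<forall>x\<in>car A. \<forall>y\<in>car A. \<forall>z\<in>car A. mul A (mul A x y) z = mul A x (mul A y z)) \<and>
     (\<forall>x\<in>car A. mul A x (alg.top A) = x) \<and>
     (\<forall>x\<in>car A. \<forall>y\<in>car A. \<forall>z\<in>car A. le A (mul A x y) z \<longleftrightarrow> le A x (imp A y z)) \<and>
     (\<forall>x\<in>car A. \<forall>y\<in>car A. mul A x (imp A x y) = meet A x y) \<and>
     (\<forall>x\<in>car A. \<forall>y\<in>car A. join A (imp A x y) (imp A y x) = alg.top A) \<and>
     (\<forall>x\<in>car A. neg A (neg A x) = x)"

definition MV :: "'i set \<Rightarrow> ('i, 'a) alg set" where
  "MV I = {A. lang_algebra I A \<and> mv_algebra A \<and>
     (\<forall>i\<in>I.
        (\<forall>x\<in>car A. \<forall>y\<in>car A. box A i (meet A x y) = meet A (box A i x) (box A i y)) \<and>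
        (\<forall>x\<in>car A. \<forall>y\<in>car A. box A i (mul A x y) = mul A (box A i x) (box A i y)) \<and>
        box A i (alg.bot A) = alg.bot A \<and>
        box A i (alg.top A) = alg.top A)}"

definition interior_operator :: "('i, 'a) alg \<Rightarrow> ('a \<Rightarrow> 'a) \<Rightarrow> bool" where
  "interior_operator A f \<longleftrightarrow>
     (\<forall>x\<in>car A. \<forall>y\<in>car A. le A x y \<longrightarrow> le A (f x) (f y)) \<and>
     (\<forall>x\<in>car A. le A (f x) x) \<and>
     (\<forall>x\<in>car A. f (f x) = f x)"

definition S4MV_I :: "'i set \<Rightarrow> ('i, 'a) alg set" where
  "S4MV_I I = {A \<in> MV I. \<forall>i\<in>I. interior_operator A (box A i)}"

definition S4MV :: "(s4_conn, 'a) alg set" where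
  "S4MV = S4MV_I {Nec}"

definition past :: "(tense_conn, 'a) alg \<Rightarrow> 'a \<Rightarrow> 'a" where
  "past A x = neg A (box A H (neg A x))"

definition S4tMV :: "(tense_conn, 'a) alg set" where
  "S4tMV = {A \<in> S4MV_I {G, H}.
     \<forall>x\<in>car A. \<forall>y\<in>car A. le A x (box A G y) \<longleftrightarrow> le A (past A x) y}"


section \<open>Equational consequence, quasivarieties and varieties\<close>

type_synonym 'i eqn = "'i fm \<times> 'i fm"

primrec eval :: "('i, 'a) alg \<Rightarrow> (nat \<Rightarrow> 'a) \<Rightarrow> 'i fm \<Rightarrow> 'a" where
  "eval A v (Var n) = v n"
| "eval A v Zero = alg.bot A"
| "eval A v One = alg.top A"
| "eval A v (\<phi> \<^bold>\<and> \<psi>) = meet A (eval A v \<phi>) (eval A v \<psi>)"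
| "eval A v (\<phi> \<^bold>\<or> \<psi>) = join A (eval A v \<phi>) (eval A v \<psi>)"
| "eval A v (\<phi> \<^bold>\<cdot> \<psi>) = mul A (eval A v \<phi>) (eval A v \<psi>)"
| "eval A v (\<phi> \<^bold>\<rightarrow> \<psi>) = imp A (eval A v \<phi>) (eval A v \<psi>)"
| "eval A v (Box i \<phi>) = box A i (eval A v \<phi>)"

definition sat :: "('i, 'a) alg \<Rightarrow> (nat \<Rightarrow> 'a) \<Rightarrow> 'i eqn \<Rightarrow> bool" where
  "sat A v e \<longleftrightarrow> eval A v (fst e) = eval A v (snd e)"

definition eq_conseq :: "('i, 'a) alg set \<Rightarrow> 'i eqn set \<Rightarrow> 'i eqn \<Rightarrow> bool" where
  "eq_conseq K \<Theta> e \<longleftrightarrow>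
     (\<forall>A\<in>K. \<forall>v. range v \<subseteq> car A \<longrightarrow> (\<forall>d\<in>\<Theta>. sat A v d) \<longrightarrow> sat A v e)"

definition quasivariety :: "'i set \<Rightarrow> ('i, 'a) alg set \<Rightarrow> bool" where
  "quasivariety I K \<longleftrightarrow>
     (\<exists>Q. (\<forall>(\<Theta>, e)\<in>Q. finite \<Theta> \<and> \<Theta> \<subseteq> Fm I \<times> Fm I \<and> e \<in> Fm I \<times> Fm I) \<and>
        K = {A. lang_algebra I A \<and> (\<forall>(\<Theta>, e)\<in>Q. eq_conseq {A} \<Theta> e)})"

definition variety :: "'i set \<Rightarrow> ('i, 'a) alg set \<Rightarrow> bool" where
  "variety I K \<longleftrightarrow>
     (\<exists>E \<subseteq> Fm I \<times> Fm I. K = {A. lang_algebra I A \<and> (\<forall>e\<in>E. eq_conseq {A} {} e)})"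


section \<open>Algebraizability in the sense of Blok and Pigozzi\<close>

definition deductive_system :: "'i set \<Rightarrow> ('i fm set \<Rightarrow> 'i fm \<Rightarrow> bool) \<Rightarrow> bool" where
  "deductive_system I C \<longleftrightarrow>
     (\<forall>\<Gamma> \<subseteq> Fm I. \<forall>\<phi>\<in>\<Gamma>. C \<Gamma> \<phi>) \<and>
     (\<forall>\<Gamma> \<subseteq> Fm I. \<forall>\<Sigma> \<subseteq> Fm I. \<forall>\<phi>\<in>Fm I. (\<forall>\<psi>\<in>\<Sigma>. C \<Gamma> \<psi>) \<longrightarrow> C \<Sigma> \<phi> \<longrightarrow> C \<Gamma> \<phi>) \<and>
     (\<forall>\<Gamma> \<subseteq> Fm I. \<forall>\<phi>\<in>Fm I. C \<Gamma> \<phi> \<longrightarrow> (\<exists>\<Gamma>' \<subseteq> \<Gamma>. finite \<Gamma>' \<and> C \<Gamma>' \<phi>)) \<and>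
     (\<forall>\<sigma>. range \<sigma> \<subseteq> Fm I \<longrightarrow>
        (\<forall>\<Gamma> \<subseteq> Fm I. \<forall>\<phi>\<in>Fm I. C \<Gamma> \<phi> \<longrightarrow> C (subst \<sigma> ` \<Gamma>) (subst \<sigma> \<phi>)))"

text \<open>Defining equations are equations in the single variable \<open>Var 0\<close>; equivalence formulas
  are formulas in the variables \<open>Var 0\<close> and \<open>Var 1\<close>.\<close>

definition defining_equations :: "'i set \<Rightarrow> 'i eqn set \<Rightarrow> bool" where
  "defining_equations I \<tau> \<longleftrightarrow> finite \<tau> \<and>
     (\<forall>(\<delta>, \<epsilon>)\<in>\<tau>. \<delta> \<in> Fm I \<and> \<epsilon> \<in> Fm I \<and> vars \<delta> \<subseteq> {0} \<and> vars \<epsilon> \<subseteq> {0})"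

definition equivalence_formulas :: "'i set \<Rightarrow> 'i fm set \<Rightarrow> bool" where
  "equivalence_formulas I \<Delta> \<longleftrightarrow> finite \<Delta> \<and> (\<forall>\<delta>\<in>\<Delta>. \<delta> \<in> Fm I \<and> vars \<delta> \<subseteq> {0, 1})"

definition inst_eqs :: "'i eqn set \<Rightarrow> 'i fm \<Rightarrow> 'i eqn set" where
  "inst_eqs \<tau> \<phi> = (\<lambda>(\<delta>, \<epsilon>). (subst (\<lambda>_. \<phi>) \<delta>, subst (\<lambda>_. \<phi>) \<epsilon>)) ` \<tau>"

definition inst_fms :: "'i fm set \<Rightarrow> 'i fm \<Rightarrow> 'i fm \<Rightarrow> 'i fm set" where
  "inst_fms \<Delta> \<phi> \<psi> = subst (\<lambda>n. if n = 0 then \<phi> else \<psi>) ` \<Delta>"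

definition equivalent_algebraic_semantics ::
  "'i set \<Rightarrow> ('i fm set \<Rightarrow> 'i fm \<Rightarrow> bool) \<Rightarrow> 'i eqn set \<Rightarrow> 'i fm set \<Rightarrow> ('i, 'a) alg set \<Rightarrow> bool"
where
  "equivalent_algebraic_semantics I C \<tau> \<Delta> K \<longleftrightarrow>
     deductive_system I C \<and> defining_equations I \<tau> \<and> equivalence_formulas I \<Delta> \<and>
     (\<forall>A\<in>K. lang_algebra I A) \<and>
     (\<forall>\<Gamma> \<subseteq> Fm I. \<forall>\<phi>\<in>Fm I.
        C \<Gamma> \<phi> \<longleftrightarrow> (\<forall>e\<in>inst_eqs \<tau> \<phi>. eq_conseq K (\<Union>\<gamma>\<in>\<Gamma>. inst_eqs \<tau> \<gamma>) e)) \<and>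
     (\<forall>\<phi>\<in>Fm I. \<forall>\<psi>\<in>Fm I.
        (\<forall>e\<in>(\<Union>\<chi>\<in>inst_fms \<Delta> \<phi> \<psi>. inst_eqs \<tau> \<chi>). eq_conseq K {(\<phi>, \<psi>)} e) \<and>
        eq_conseq K (\<Union>\<chi>\<in>inst_fms \<Delta> \<phi> \<psi>. inst_eqs \<tau> \<chi>) (\<phi>, \<psi>))"

text \<open>Classes of algebras are classes of algebras whose carrier is a subset of a universe
  \<open>'a\<close>, which is passed explicitly where it does not occur otherwise.\<close>

definition algebraizable ::
  "'a itself \<Rightarrow> 'i set \<Rightarrow> ('i fm set \<Rightarrow> 'i fm \<Rightarrow> bool) \<Rightarrow> 'i eqn set \<Rightarrow> 'i fm set \<Rightarrow> bool"
where
  "algebraizable _ I C \<tau> \<Delta> \<longleftrightarrow>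
     (\<exists>K :: ('i, 'a) alg set. equivalent_algebraic_semantics I C \<tau> \<Delta> K)"

text \<open>The equivalent variety semantics is the unique quasivariety that is an equivalent
  algebraic semantics (with respect to any choice of defining equations and equivalence
  formulas), in case it is a variety.\<close>

definition equivalent_variety_semantics ::
  "'i set \<Rightarrow> ('i fm set \<Rightarrow> 'i fm \<Rightarrow> bool) \<Rightarrow> 'i eqn set \<Rightarrow> 'i fm set \<Rightarrow> ('i, 'a) alg set \<Rightarrow> bool"
where
  "equivalent_variety_semantics I C \<tau> \<Delta> K \<longleftrightarrow>
     variety I K \<and> equivalent_algebraic_semantics I C \<tau> \<Delta> K \<and>
     (\<forall>K' \<tau>' \<Delta>'. quasivariety I K' \<and> equivalent_algebraic_semantics I C \<tau>' \<Delta>' K' \<longrightarrow> K' = K)"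

definition one_eq :: "'i eqn set" where
  "one_eq = {(Var 0, One)}"

definition iff_fm :: "'i fm set" where
  "iff_fm = {Var 0 \<^bold>\<leftrightarrow> Var 1}"

end

theory Submission imports Defs "HOL-Library.Countable" begin

text \<open>All four logics are axiomatic extensions of the logic \<open>L I\<close> by a substitution-closed set \<open>X\<close>
  of formulas, and the corresponding classes are cut out of \<open>MV I\<close> by the equations \<open>\<alpha> \<approx> 1\<close> with
  \<open>\<alpha> \<in> X\<close>, so it suffices to treat such extensions uniformly. Completeness comes from the
  Lindenbaum algebra of a theory, copied into the universe \<open>'a\<close>: writing \<open>\<phi> \<sqsubseteq> \<psi>\<close> for derivability of
  \<open>\<phi> \<rightarrow> \<psi>\<close>, the axioms say that formulas form a divisible, prelinear, involutive residuated
  lattice up to equivalence. For uniqueness, let \<open>(\<tau>, \<Delta>, K)\<close> and \<open>(\<tau>', \<Delta>', K')\<close> be equivalent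
  algebraic semantics of the same logic. Since \<open>\<Delta>(a, a)\<close> is derivable, \<open>a \<approx> b\<close> forces \<open>\<tau>'(\<Delta>(a, b))\<close>
  in \<open>K'\<close>, so equational consequence over \<open>K\<close> can be translated into the logic and back to \<open>K'\<close>;
  both classes thus satisfy the same quasi-equations.\<close>

section \<open>Formulas\<close>

lemma Fm_simps [simp]:
  "Var n \<in> Fm I" "Zero \<in> Fm I" "One \<in> Fm I"
  "\<phi> \<^bold>\<and> \<psi> \<in> Fm I \<longleftrightarrow> \<phi> \<in> Fm I \<and> \<psi> \<in> Fm I"
  "\<phi> \<^bold>\<or> \<psi> \<in> Fm I \<longleftrightarrow> \<phi> \<in> Fm I \<and> \<psi> \<in> Fm I"
  "\<phi> \<^bold>\<cdot> \<psi> \<in> Fm I \<longleftrightarrow> \<phi> \<in> Fm I \<and> \<psi> \<in> Fm I"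
  "\<phi> \<^bold>\<rightarrow> \<psi> \<in> Fm I \<longleftrightarrow> \<phi> \<in> Fm I \<and> \<psi> \<in> Fm I"
  "Box i \<phi> \<in> Fm I \<longleftrightarrow> i \<in> I \<and> \<phi> \<in> Fm I"
  by (auto simp: Fm_def)

lemma subst_in_Fm: "\<phi> \<in> Fm I \<Longrightarrow> range \<sigma> \<subseteq> Fm I \<Longrightarrow> subst \<sigma> \<phi> \<in> Fm I"
  by (induction \<phi>) auto

lemma eval_in_car:
  "lang_algebra I A \<Longrightarrow> range v \<subseteq> car A \<Longrightarrow> \<phi> \<in> Fm I \<Longrightarrow> eval A v \<phi> \<in> car A"
  by (induction \<phi>) (auto simp: lang_algebra_def)

lemma eval_subst: "eval A v (subst \<sigma> \<phi>) = eval A (\<lambda>n. eval A v (\<sigma> n)) \<phi>"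
  by (induction \<phi>) simp_all

lemma L_axioms_subset_Fm: "L_axioms I \<subseteq> Fm I"
proof
  fix \<alpha> assume "\<alpha> \<in> L_axioms I"
  then show "\<alpha> \<in> Fm I" by induction simp_all
qed

lemma subst_L_axioms:
  assumes "\<alpha> \<in> L_axioms I" and "range \<sigma> \<subseteq> Fm I"
  shows "subst \<sigma> \<alpha> \<in> L_axioms I"
  using assms(1)
  by induction (simp_all add: subst_in_Fm[OF _ assms(2)] L_axioms.intros)

section \<open>The derivability relation\<close>

lemma derives_in_Fm:
  assumes "derives I Ax \<Gamma> \<phi>" and "Ax \<subseteq> Fm I" and "\<Gamma> \<subseteq> Fm I"
  shows "\<phi> \<in> Fm I"
  using assms(1) by induction (use assms(2,3) in auto)

lemma derives_cut:
  assumes "derives I Ax \<Sigma> \<phi>" and "\<And>\<psi>. \<psi> \<in> \<Sigma> \<Longrightarrow> derives I Ax \<Gamma> \<psi>"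
  shows "derives I Ax \<Gamma> \<phi>"
  using assms(1) by induction (use assms(2) in \<open>auto intro: derives.intros\<close>)

lemma derives_mono:
  "derives I Ax \<Sigma> \<phi> \<Longrightarrow> \<Sigma> \<subseteq> \<Gamma> \<Longrightarrow> derives I Ax \<Gamma> \<phi>"
  by (erule derives_cut) (auto intro: derives.Hyp)

lemma derives_finitary:
  assumes "derives I Ax \<Gamma> \<phi>"
  shows "\<exists>\<Gamma>'\<subseteq>\<Gamma>. finite \<Gamma>' \<and> derives I Ax \<Gamma>' \<phi>"
  using assms
proof induction
  case (Ax \<phi>)
  then show ?case by (intro exI[of _ "{}"]) (auto intro: derives.Ax)
next
  case (Hyp \<phi>)
  then show ?case by (intro exI[of _ "{\<phi>}"]) (auto intro: derives.Hyp)
next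
  case (MP \<phi> \<psi>)
  then obtain \<Gamma>1 \<Gamma>2 where "\<Gamma>1 \<subseteq> \<Gamma>" "finite \<Gamma>1" "derives I Ax \<Gamma>1 \<phi>"
    and "\<Gamma>2 \<subseteq> \<Gamma>" "finite \<Gamma>2" "derives I Ax \<Gamma>2 (\<phi> \<^bold>\<rightarrow> \<psi>)" by blast
  then show ?case
    by (intro exI[of _ "\<Gamma>1 \<union> \<Gamma>2"]) (auto intro: derives.MP derives_mono)
next
  case (Nec \<phi> i)
  then show ?case by (blast intro: derives.Nec)
qed

lemma derives_subst:
  assumes "derives I Ax \<Gamma> \<phi>" and "\<And>\<alpha>. \<alpha> \<in> Ax \<Longrightarrow> subst \<sigma> \<alpha> \<in> Ax"
  shows "derives I Ax (subst \<sigma> ` \<Gamma>) (subst \<sigma> \<phi>)"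
  using assms(1) by induction (auto intro: derives.intros assms(2))

lemma deductive_system_derives:
  assumes "\<And>\<sigma> \<alpha>. range \<sigma> \<subseteq> Fm I \<Longrightarrow> \<alpha> \<in> Ax \<Longrightarrow> subst \<sigma> \<alpha> \<in> Ax"
  shows "deductive_system I (derives I Ax)"
  unfolding deductive_system_def
  by (auto intro: derives.Hyp derives_cut derives_finitary derives_subst assms)

section \<open>MV-algebras\<close>

locale mv =
  fixes A :: "('i, 'a) alg"
  assumes mv: "mv_algebra A"
begin


abbreviation inf_op (infixr "\<sqinter>" 70) where "x \<sqinter> y \<equiv> meet A x y"
abbreviation sup_op (infixr "\<squnion>" 65) where "x \<squnion> y \<equiv> join A x y"
abbreviation mul_op (infixr "\<odot>" 75) where "x \<odot> y \<equiv> mul A x y"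
abbreviation imp_op (infixr "\<leadsto>" 60) where "x \<leadsto> y \<equiv> imp A x y"
abbreviation le_op (infix "\<preceq>" 50) where "x \<preceq> y \<equiv> le A x y"
abbreviation C where "C \<equiv> car A"
abbreviation bot_el ("\<zero>") where "\<zero> \<equiv> alg.bot A"
abbreviation top_el ("\<one>") where "\<one> \<equiv> alg.top A"

lemma closed [simp]:
  "\<zero> \<in> C" "\<one> \<in> C"
  "\<lbrakk>x \<in> C; y \<in> C\<rbrakk> \<Longrightarrow> x \<sqinter> y \<in> C"
  "\<lbrakk>x \<in> C; y \<in> C\<rbrakk> \<Longrightarrow> x \<squnion> y \<in> C"
  "\<lbrakk>x \<in> C; y \<in> C\<rbrakk> \<Longrightarrow> x \<odot> y \<in> C"
  "\<lbrakk>x \<in> C; y \<in> C\<rbrakk> \<Longrightarrow> x \<leadsto> y \<in> C"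
  "x \<in> C \<Longrightarrow> neg A x \<in> C"
  using mv unfolding mv_algebra_def lang_algebra_def neg_def by auto

lemma
  shows meet_comm: "\<lbrakk>x \<in> C; y \<in> C\<rbrakk> \<Longrightarrow> x \<sqinter> y = y \<sqinter> x"
    and join_comm: "\<lbrakk>x \<in> C; y \<in> C\<rbrakk> \<Longrightarrow> x \<squnion> y = y \<squnion> x"
    and meet_assoc: "\<lbrakk>x \<in> C; y \<in> C; z \<in> C\<rbrakk> \<Longrightarrow> (x \<sqinter> y) \<sqinter> z = x \<sqinter> (y \<sqinter> z)"
    and join_assoc: "\<lbrakk>x \<in> C; y \<in> C; z \<in> C\<rbrakk> \<Longrightarrow> (x \<squnion> y) \<squnion> z = x \<squnion> (y \<squnion> z)"
    and meet_join: "\<lbrakk>x \<in> C; y \<in> C\<rbrakk> \<Longrightarrow> x \<sqinter> (x \<squnion> y) = x"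
    and join_meet: "\<lbrakk>x \<in> C; y \<in> C\<rbrakk> \<Longrightarrow> x \<squnion> (x \<sqinter> y) = x"
    and bot_le [simp]: "x \<in> C \<Longrightarrow> \<zero> \<preceq> x"
    and le_top [simp]: "x \<in> C \<Longrightarrow> x \<preceq> \<one>"
    and mul_comm: "\<lbrakk>x \<in> C; y \<in> C\<rbrakk> \<Longrightarrow> x \<odot> y = y \<odot> x"
    and mul_assoc: "\<lbrakk>x \<in> C; y \<in> C; z \<in> C\<rbrakk> \<Longrightarrow> (x \<odot> y) \<odot> z = x \<odot> (y \<odot> z)"
    and mul_top [simp]: "x \<in> C \<Longrightarrow> x \<odot> \<one> = x"
    and residuation: "\<lbrakk>x \<in> C; y \<in> C; z \<in> C\<rbrakk> \<Longrightarrow> x \<odot> y \<preceq> z \<longleftrightarrow> x \<preceq> y \<leadsto> z"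
    and divisible: "\<lbrakk>x \<in> C; y \<in> C\<rbrakk> \<Longrightarrow> x \<odot> (x \<leadsto> y) = x \<sqinter> y"
    and prelinear: "\<lbrakk>x \<in> C; y \<in> C\<rbrakk> \<Longrightarrow> (x \<leadsto> y) \<squnion> (y \<leadsto> x) = \<one>"
    and neg_neg: "x \<in> C \<Longrightarrow> neg A (neg A x) = x"
  using mv unfolding mv_algebra_def by meson+

section \<open>The order of an MV-algebra\<close>

lemma meet_idem: "x \<in> C \<Longrightarrow> x \<sqinter> x = x"
  \<comment> \<open>Absorption twice: x \<squnion> (x \<sqinter> x) = x, and meeting x with the
    left-hand side returns x.\<close>
  by (metis closed(3) join_meet meet_join)

lemma le_refl [simp]: "x \<in> C \<Longrightarrow> x \<preceq> x"
  by (simp add: le_def meet_idem)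

lemma le_trans: "\<lbrakk>x \<preceq> y; y \<preceq> z; x \<in> C; y \<in> C; z \<in> C\<rbrakk> \<Longrightarrow> x \<preceq> z"
  by (metis le_def meet_assoc)

lemma le_antisym: "\<lbrakk>x \<preceq> y; y \<preceq> x; x \<in> C; y \<in> C\<rbrakk> \<Longrightarrow> x = y"
  by (metis le_def meet_comm)

lemma meet_le1 [simp]: "\<lbrakk>x \<in> C; y \<in> C\<rbrakk> \<Longrightarrow> x \<sqinter> y \<preceq> x"
  by (metis closed(3) le_def meet_assoc meet_comm meet_idem)

lemma meet_le2 [simp]: "\<lbrakk>x \<in> C; y \<in> C\<rbrakk> \<Longrightarrow> x \<sqinter> y \<preceq> y"
  by (metis meet_comm meet_le1)

lemma le_iff_join: "\<lbrakk>x \<in> C; y \<in> C\<rbrakk> \<Longrightarrow> x \<preceq> y \<longleftrightarrow> x \<squnion> y = y"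
  by (metis join_comm join_meet le_def meet_comm meet_join)

lemma le_join1 [simp]: "\<lbrakk>x \<in> C; y \<in> C\<rbrakk> \<Longrightarrow> x \<preceq> x \<squnion> y"
  by (simp add: le_def meet_join)

lemma le_join2 [simp]: "\<lbrakk>x \<in> C; y \<in> C\<rbrakk> \<Longrightarrow> y \<preceq> x \<squnion> y"
  by (metis join_comm le_join1)

lemma join_least: "\<lbrakk>x \<preceq> z; y \<preceq> z; x \<in> C; y \<in> C; z \<in> C\<rbrakk> \<Longrightarrow> x \<squnion> y \<preceq> z"
  by (simp add: le_iff_join join_assoc)

section \<open>Residuation, implication and negation\<close>

lemma imp_eq_top_iff: "\<lbrakk>x \<in> C; y \<in> C\<rbrakk> \<Longrightarrow> x \<leadsto> y = \<one> \<longleftrightarrow> x \<preceq> y"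
  \<comment> \<open>Residuation at the top element: \<one> \<odot> x \<preceq> y exactly when \<one>
    \<preceq> x \<leadsto> y.\<close>
  using residuation[of \<one> x y] mul_comm[of \<one> x] le_antisym[of "x \<leadsto> y" \<one>] by auto

lemma meet_eq_top_iff: "\<lbrakk>x \<in> C; y \<in> C\<rbrakk> \<Longrightarrow> x \<sqinter> y = \<one> \<longleftrightarrow> x = \<one> \<and> y = \<one>"
  by (metis closed(2) le_antisym le_refl le_top meet_idem meet_le1 meet_le2)

text \<open>The algebraic reason why the biconditional can serve as the sole equivalence formula: by
  antisymmetry it takes the designated value only on equal elements.\<close>

lemma iff_eq_top_iff: "\<lbrakk>x \<in> C; y \<in> C\<rbrakk> \<Longrightarrow> (x \<leadsto> y) \<sqinter> (y \<leadsto> x) = \<one> \<longleftrightarrow> x = y"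
  by (auto simp: meet_eq_top_iff imp_eq_top_iff intro: le_antisym)

lemma mul_imp_le: "\<lbrakk>x \<in> C; y \<in> C\<rbrakk> \<Longrightarrow> x \<odot> (x \<leadsto> y) \<preceq> y"
  by (simp add: divisible)

lemma imp_mul_le: "\<lbrakk>x \<in> C; y \<in> C\<rbrakk> \<Longrightarrow> (x \<leadsto> y) \<odot> x \<preceq> y"
  by (simp add: residuation)

lemma mul_mono: "\<lbrakk>x \<preceq> y; x \<in> C; y \<in> C; z \<in> C\<rbrakk> \<Longrightarrow> x \<odot> z \<preceq> y \<odot> z"
  by (simp add: residuation) (meson closed(5,6) le_refl le_trans residuation)

lemma mul_le2: "\<lbrakk>x \<in> C; y \<in> C\<rbrakk> \<Longrightarrow> x \<odot> y \<preceq> y"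
  by (metis closed(2) le_top mul_comm mul_mono mul_top)

lemma neg_antimono: "\<lbrakk>x \<preceq> y; x \<in> C; y \<in> C\<rbrakk> \<Longrightarrow> neg A y \<preceq> neg A x"
  unfolding neg_def
  by (metis closed(1,5,6) imp_mul_le le_trans mul_comm mul_mono residuation)

lemma neg_le_swap: "\<lbrakk>x \<in> C; y \<in> C\<rbrakk> \<Longrightarrow> neg A x \<preceq> y \<longleftrightarrow> neg A y \<preceq> x"
  by (metis closed(7) neg_antimono neg_neg)

text \<open>Behind (A2): after two residuations and a reordering of factors, modus ponens is applied
  first to x \<leadsto> y and then to y \<leadsto> z.\<close>

lemma imp_trans:
  assumes "x \<in> C" "y \<in> C" "z \<in> C"
  shows "x \<leadsto> y \<preceq> (y \<leadsto> z) \<leadsto> (x \<leadsto> z)"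
proof -
  have "((x \<leadsto> y) \<odot> (y \<leadsto> z)) \<odot> x = ((x \<leadsto> y) \<odot> x) \<odot> (y \<leadsto> z)"
    using assms by (metis closed(6) mul_assoc mul_comm)
  also have "\<dots> \<preceq> y \<odot> (y \<leadsto> z)"
    using assms by (simp add: imp_mul_le mul_mono)
  finally have "((x \<leadsto> y) \<odot> (y \<leadsto> z)) \<odot> x \<preceq> z"
    using assms by (meson closed(5,6) le_trans mul_imp_le)
  then show ?thesis using assms by (simp add: residuation)
qed

text \<open>By residuation and associativity both sides have the same lower bounds. As an equation
  it covers (A5) and (A6) together.\<close>

lemma imp_imp:
  assumes "x \<in> C" "y \<in> C" "z \<in> C"
  shows "(x \<odot> y) \<leadsto> z = x \<leadsto> (y \<leadsto> z)"
proof -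
  have "w \<preceq> x \<leadsto> (y \<leadsto> z) \<longleftrightarrow> w \<preceq> (x \<odot> y) \<leadsto> z" if "w \<in> C" for w
    using assms that residuation mul_assoc by (metis closed(5,6))
  then show ?thesis using assms by (metis closed(5,6) le_antisym le_refl)
qed

text \<open>Behind (A12): with the left-hand side as \<open>?w\<close>, both x and z lie below
  \<open>?w\<close> \<leadsto> y, hence so does their join; residuation and commutativity exchange
  the two roles.\<close>

lemma join_imp:
  assumes "x \<in> C" "y \<in> C" "z \<in> C"
  shows "(x \<leadsto> y) \<sqinter> (z \<leadsto> y) \<preceq> (x \<squnion> z) \<leadsto> y"
proof -
  let ?w = "(x \<leadsto> y) \<sqinter> (z \<leadsto> y)"
  have w: "?w \<in> C" using assms by simp
  have "x \<preceq> ?w \<leadsto> y" "z \<preceq> ?w \<leadsto> y"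
    using assms w by (metis closed(6) meet_le1 meet_le2 residuation mul_comm)+
  then have "x \<squnion> z \<preceq> ?w \<leadsto> y" using assms w by (simp add: join_least)
  then show ?thesis using assms w by (metis closed(4) residuation mul_comm)
qed

end

section \<open>Validity of the axioms in MV(I)-algebras\<close>

lemma MV_mv: "A \<in> MV I \<Longrightarrow> mv A"
  by (simp add: MV_def mv_def)

lemma MV_lang_algebra: "A \<in> MV I \<Longrightarrow> lang_algebra I A"
  by (simp add: MV_def)

lemma MV_box_mono:
  assumes "A \<in> MV I" "i \<in> I" "x \<in> car A" "y \<in> car A" "le A x y"
  shows "le A (box A i x) (box A i y)"
  using assms unfolding MV_def le_def by fastforce

lemma L_axioms_valid:
  assumes A: "A \<in> MV I" and v: "range v \<subseteq> car A" and "\<alpha> \<in> L_axioms I"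
  shows "eval A v \<alpha> = alg.top A"
proof -
  interpret mv A using A by (rule MV_mv)
  note [simp] = eval_in_car[OF MV_lang_algebra[OF A] v]
  have box [simp]: "i \<in> I \<Longrightarrow> x \<in> car A \<Longrightarrow> box A i x \<in> car A" for i x
    using A by (simp add: MV_def lang_algebra_def)
  show ?thesis
    using assms(3)
  proof cases
    case (Box_K i \<phi> \<psi>)
    let ?x = "eval A v \<phi>" and ?y = "eval A v \<psi>"
    \<comment> \<open>Preservation of products reduces (K) to monotonicity applied to (x \<leadsto>
      y) \<odot> x \<preceq> y.\<close>
    have "box A i (?x \<leadsto> ?y) \<odot> box A i ?x = box A i ((?x \<leadsto> ?y) \<odot> ?x)"
      using A Box_K by (simp add: MV_def)
    also have "\<dots> \<preceq> box A i ?y"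
      using Box_K by (intro MV_box_mono[OF A]) (simp_all add: imp_mul_le)
    finally show ?thesis using Box_K by (simp add: imp_eq_top_iff residuation)
  next
    case (A5 \<phi> \<psi> \<chi>)
    then show ?thesis by (simp add: imp_imp imp_eq_top_iff)
  next
    case (A6 \<phi> \<psi> \<chi>)
    then show ?thesis by (simp add: imp_imp imp_eq_top_iff)
  qed (use A in \<open>simp_all add: imp_eq_top_iff imp_trans mul_comm mul_le2 divisible
      meet_comm join_imp prelinear iff_eq_top_iff neg_neg[unfolded neg_def] MV_def\<close>)
qed

section \<open>Lindenbaum algebras\<close>

text \<open>\<open>Ax\<close> may be any set of axioms extending those of \<open>L I\<close>, so
  that one argument serves all extensions. The premises \<open>\<Gamma>\<close> are fixed, and
  necessitation applies to them as well.\<close>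

locale L_theory =
  fixes I :: "'i set" and Ax \<Gamma> :: "'i fm set"
  assumes L_axioms_Ax: "L_axioms I \<subseteq> Ax" and One_Ax: "One \<in> Ax"
    and Ax_Fm: "Ax \<subseteq> Fm I" and \<Gamma>_Fm: "\<Gamma> \<subseteq> Fm I"
begin

abbreviation provable ("\<turnstile> _" [40] 40) where "\<turnstile> \<phi> \<equiv> derives I Ax \<Gamma> \<phi>"

abbreviation prec (infix "\<sqsubseteq>" 50) where "\<phi> \<sqsubseteq> \<psi> \<equiv> (\<turnstile> \<phi> \<^bold>\<rightarrow> \<psi>)"

abbreviation F where "F \<equiv> Fm I"

lemma thm_Fm: "\<turnstile> \<phi> \<Longrightarrow> \<phi> \<in> F"
  by (rule derives_in_Fm[OF _ Ax_Fm \<Gamma>_Fm])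

lemma ax: "\<alpha> \<in> L_axioms I \<Longrightarrow> \<turnstile> \<alpha>"
  using L_axioms_Ax by (auto intro: derives.Ax)

lemma thm_One: "\<turnstile> One"
  by (rule derives.Ax[OF One_Ax])

lemma mp: "\<phi> \<sqsubseteq> \<psi> \<Longrightarrow> \<turnstile> \<phi> \<Longrightarrow> \<turnstile> \<psi>"
  by (rule derives.MP)

section \<open>Formulas as a residuated commutative monoid\<close>

lemma prec_refl: "\<phi> \<in> F \<Longrightarrow> \<phi> \<sqsubseteq> \<phi>"
  by (simp add: ax A1)

lemma prec_trans [trans]:
  assumes "\<phi> \<sqsubseteq> \<psi>" "\<psi> \<sqsubseteq> \<chi>"
  shows "\<phi> \<sqsubseteq> \<chi>"
proof -
  have "\<phi> \<^bold>\<rightarrow> \<psi> \<sqsubseteq> (\<psi> \<^bold>\<rightarrow> \<chi>) \<^bold>\<rightarrow> (\<phi> \<^bold>\<rightarrow> \<chi>)"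
    using assms[THEN thm_Fm] by (intro ax A2) auto
  then show ?thesis using assms mp by metis
qed

lemma dot_comm: "\<lbrakk>\<phi> \<in> F; \<psi> \<in> F\<rbrakk> \<Longrightarrow> \<phi> \<^bold>\<cdot> \<psi> \<sqsubseteq> \<psi> \<^bold>\<cdot> \<phi>"
  by (simp add: ax A3)

lemma dot_prec2: "\<lbrakk>\<phi> \<in> F; \<psi> \<in> F\<rbrakk> \<Longrightarrow> \<phi> \<^bold>\<cdot> \<psi> \<sqsubseteq> \<psi>"
  by (simp add: ax A4)

lemma dot_prec1: "\<lbrakk>\<phi> \<in> F; \<psi> \<in> F\<rbrakk> \<Longrightarrow> \<phi> \<^bold>\<cdot> \<psi> \<sqsubseteq> \<phi>"
  by (rule prec_trans[OF dot_comm dot_prec2])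

lemma resid: "\<lbrakk>\<phi> \<in> F; \<psi> \<in> F; \<chi> \<in> F\<rbrakk> \<Longrightarrow> \<phi> \<^bold>\<cdot> \<psi> \<sqsubseteq> \<chi> \<longleftrightarrow> \<phi> \<sqsubseteq> \<psi> \<^bold>\<rightarrow> \<chi>"
  using mp[OF ax[OF A5]] mp[OF ax[OF A6]] by blast

text \<open>Residuating the projection of a product to its first factor gives \<phi> \<sqsubseteq>
  \<chi> \<rightarrow> \<phi>, from which \<phi> is detached.\<close>

lemma weaken:
  assumes "\<turnstile> \<phi>" "\<chi> \<in> F"
  shows "\<chi> \<sqsubseteq> \<phi>"
  using resid[of \<phi> \<chi> \<phi>] dot_prec1[of \<phi> \<chi>] thm_Fm[OF assms(1)] assms
    mp[of \<phi> "\<chi> \<^bold>\<rightarrow> \<phi>"] by blast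

text \<open>Derivability becomes a statement about the order. That \<open>One\<close> is a theorem
  is what makes the direction from right to left work.\<close>

lemma thm_iff: "\<phi> \<in> F \<Longrightarrow> \<turnstile> \<phi> \<longleftrightarrow> One \<sqsubseteq> \<phi>"
  using weaken[of \<phi> One] mp[OF _ thm_One] by auto

lemma prec_imp_dot: "\<lbrakk>\<phi> \<in> F; \<psi> \<in> F\<rbrakk> \<Longrightarrow> \<phi> \<sqsubseteq> \<psi> \<^bold>\<rightarrow> \<phi> \<^bold>\<cdot> \<psi>"
  using resid[of \<phi> \<psi> "\<phi> \<^bold>\<cdot> \<psi>"] by (simp add: prec_refl)

lemma imp_dot_prec: "\<lbrakk>\<phi> \<in> F; \<psi> \<in> F\<rbrakk> \<Longrightarrow> (\<phi> \<^bold>\<rightarrow> \<psi>) \<^bold>\<cdot> \<phi> \<sqsubseteq> \<psi>"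
  by (simp add: resid prec_refl)

lemma dot_mono1:
  assumes "\<phi> \<sqsubseteq> \<phi>'" "\<psi> \<in> F"
  shows "\<phi> \<^bold>\<cdot> \<psi> \<sqsubseteq> \<phi>' \<^bold>\<cdot> \<psi>"
  using resid[of \<phi> \<psi> "\<phi>' \<^bold>\<cdot> \<psi>"] prec_trans[OF assms(1) prec_imp_dot] thm_Fm[OF assms(1)] assms(2)
  by simp

lemma dot_mono:
  assumes "\<phi> \<sqsubseteq> \<phi>'" "\<psi> \<sqsubseteq> \<psi>'"
  shows "\<phi> \<^bold>\<cdot> \<psi> \<sqsubseteq> \<phi>' \<^bold>\<cdot> \<psi>'"
proof -
  have F: "\<phi> \<in> F" "\<phi>' \<in> F" "\<psi> \<in> F" "\<psi>' \<in> F" using assms[THEN thm_Fm] by auto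
  have "\<phi> \<^bold>\<cdot> \<psi> \<sqsubseteq> \<phi>' \<^bold>\<cdot> \<psi>" using assms F by (simp add: dot_mono1)
  also have "\<phi>' \<^bold>\<cdot> \<psi> \<sqsubseteq> \<psi> \<^bold>\<cdot> \<phi>'" using F by (simp add: dot_comm)
  also have "\<psi> \<^bold>\<cdot> \<phi>' \<sqsubseteq> \<psi>' \<^bold>\<cdot> \<phi>'" using assms F by (simp add: dot_mono1)
  also have "\<psi>' \<^bold>\<cdot> \<phi>' \<sqsubseteq> \<phi>' \<^bold>\<cdot> \<psi>'" using F by (simp add: dot_comm)
  finally show ?thesis .
qed

text \<open>Commutativity, residuated, reads \<psi> \<sqsubseteq> \<phi> \<rightarrow> \<phi>
  \<cdot> \<psi>, and the theorem \<psi> can be detached. Together with \<open>dot_prec1\<close>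
  this makes every theorem a unit of the product.\<close>

lemma prec_dot_thm: "\<lbrakk>\<phi> \<in> F; \<turnstile> \<psi>\<rbrakk> \<Longrightarrow> \<phi> \<sqsubseteq> \<phi> \<^bold>\<cdot> \<psi>"
  using resid[of \<psi> \<phi> "\<phi> \<^bold>\<cdot> \<psi>"] dot_comm[of \<psi> \<phi>] thm_Fm[of \<psi>]
    mp[of \<psi> "\<phi> \<^bold>\<rightarrow> \<phi> \<^bold>\<cdot> \<psi>"] by simp

text \<open>Residuating out \<chi> and then \<psi> leaves an inequality with \<phi> alone on the
  left, which follows by exporting the product \<psi> \<cdot> \<chi> with (A6).\<close>

lemma dot_assoc1:
  assumes "\<phi> \<in> F" "\<psi> \<in> F" "\<chi> \<in> F"
  shows "(\<phi> \<^bold>\<cdot> \<psi>) \<^bold>\<cdot> \<chi> \<sqsubseteq> \<phi> \<^bold>\<cdot> \<psi> \<^bold>\<cdot> \<chi>"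
proof -
  have "\<phi> \<sqsubseteq> \<psi> \<^bold>\<cdot> \<chi> \<^bold>\<rightarrow> \<phi> \<^bold>\<cdot> \<psi> \<^bold>\<cdot> \<chi>" using assms by (simp add: prec_imp_dot)
  also have "\<psi> \<^bold>\<cdot> \<chi> \<^bold>\<rightarrow> \<phi> \<^bold>\<cdot> \<psi> \<^bold>\<cdot> \<chi> \<sqsubseteq> \<psi> \<^bold>\<rightarrow> \<chi> \<^bold>\<rightarrow> \<phi> \<^bold>\<cdot> \<psi> \<^bold>\<cdot> \<chi>" using assms by (simp add: ax A6)
  finally show ?thesis using assms by (simp add: resid)
qed

lemma dot_assoc2:
  assumes "\<phi> \<in> F" "\<psi> \<in> F" "\<chi> \<in> F"
  shows "\<phi> \<^bold>\<cdot> \<psi> \<^bold>\<cdot> \<chi> \<sqsubseteq> (\<phi> \<^bold>\<cdot> \<psi>) \<^bold>\<cdot> \<chi>"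
proof -
  have "\<phi> \<sqsubseteq> \<psi> \<^bold>\<rightarrow> \<chi> \<^bold>\<rightarrow> (\<phi> \<^bold>\<cdot> \<psi>) \<^bold>\<cdot> \<chi>"
    using assms prec_imp_dot[of "\<phi> \<^bold>\<cdot> \<psi>" \<chi>] by (simp add: resid)
  also have "\<psi> \<^bold>\<rightarrow> \<chi> \<^bold>\<rightarrow> (\<phi> \<^bold>\<cdot> \<psi>) \<^bold>\<cdot> \<chi> \<sqsubseteq> \<psi> \<^bold>\<cdot> \<chi> \<^bold>\<rightarrow> (\<phi> \<^bold>\<cdot> \<psi>) \<^bold>\<cdot> \<chi>" using assms by (simp add: ax A5)
  finally show ?thesis using assms by (simp add: resid)
qed

lemma imp_mono:
  assumes "\<phi>' \<sqsubseteq> \<phi>" "\<psi> \<sqsubseteq> \<psi>'"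
  shows "\<phi> \<^bold>\<rightarrow> \<psi> \<sqsubseteq> \<phi>' \<^bold>\<rightarrow> \<psi>'"
proof -
  have F: "\<phi> \<in> F" "\<phi>' \<in> F" "\<psi> \<in> F" "\<psi>' \<in> F" using assms[THEN thm_Fm] by auto
  have "(\<phi> \<^bold>\<rightarrow> \<psi>) \<^bold>\<cdot> \<phi>' \<sqsubseteq> (\<phi> \<^bold>\<rightarrow> \<psi>) \<^bold>\<cdot> \<phi>" using assms F by (simp add: dot_mono prec_refl)
  also have "(\<phi> \<^bold>\<rightarrow> \<psi>) \<^bold>\<cdot> \<phi> \<sqsubseteq> \<psi>" using F by (simp add: imp_dot_prec)
  also note assms(2)
  finally show ?thesis using F by (simp add: resid)
qed

section \<open>Divisibility and the lattice operations on formulas\<close>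

lemma divis:
  "\<lbrakk>\<phi> \<in> F; \<psi> \<in> F\<rbrakk> \<Longrightarrow> \<phi> \<^bold>\<cdot> (\<phi> \<^bold>\<rightarrow> \<psi>) \<sqsubseteq> \<phi> \<^bold>\<and> \<psi>"
  "\<lbrakk>\<phi> \<in> F; \<psi> \<in> F\<rbrakk> \<Longrightarrow> \<phi> \<^bold>\<and> \<psi> \<sqsubseteq> \<phi> \<^bold>\<cdot> (\<phi> \<^bold>\<rightarrow> \<psi>)"
  by (simp_all add: ax A7 A8)

lemma and_prec1: "\<lbrakk>\<phi> \<in> F; \<psi> \<in> F\<rbrakk> \<Longrightarrow> \<phi> \<^bold>\<and> \<psi> \<sqsubseteq> \<phi>"
  by (rule prec_trans[OF divis(2) dot_prec1]) auto

lemma and_prec2: "\<lbrakk>\<phi> \<in> F; \<psi> \<in> F\<rbrakk> \<Longrightarrow> \<phi> \<^bold>\<and> \<psi> \<sqsubseteq> \<psi>"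
  by (rule prec_trans[OF ax[OF A9] and_prec1])

text \<open>Divisibility does the work. As \<chi> \<rightarrow> \<phi> is a theorem, \<chi> lies
  below \<chi> \<cdot> (\<chi> \<rightarrow> \<phi>), that is, below \<chi> \<and> \<phi>. Commuting
  the meet turns this into \<phi> \<cdot> (\<phi> \<rightarrow> \<chi>), where \<chi> may be
  enlarged to \<psi>.\<close>

lemma and_greatest:
  assumes "\<chi> \<sqsubseteq> \<phi>" "\<chi> \<sqsubseteq> \<psi>"
  shows "\<chi> \<sqsubseteq> \<phi> \<^bold>\<and> \<psi>"
proof -
  have F: "\<phi> \<in> F" "\<psi> \<in> F" "\<chi> \<in> F" using assms[THEN thm_Fm] by auto
  have "\<chi> \<sqsubseteq> \<chi> \<^bold>\<cdot> (\<chi> \<^bold>\<rightarrow> \<phi>)" using assms F by (simp add: prec_dot_thm)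
  also have "\<chi> \<^bold>\<cdot> (\<chi> \<^bold>\<rightarrow> \<phi>) \<sqsubseteq> \<chi> \<^bold>\<and> \<phi>" using F by (simp add: divis)
  also have "\<chi> \<^bold>\<and> \<phi> \<sqsubseteq> \<phi> \<^bold>\<and> \<chi>" using F by (simp add: ax A9)
  also have "\<phi> \<^bold>\<and> \<chi> \<sqsubseteq> \<phi> \<^bold>\<cdot> (\<phi> \<^bold>\<rightarrow> \<chi>)" using F by (simp add: divis)
  also have "\<phi> \<^bold>\<cdot> (\<phi> \<^bold>\<rightarrow> \<chi>) \<sqsubseteq> \<phi> \<^bold>\<cdot> (\<phi> \<^bold>\<rightarrow> \<psi>)" using assms F by (simp add: dot_mono imp_mono prec_refl)
  also have "\<phi> \<^bold>\<cdot> (\<phi> \<^bold>\<rightarrow> \<psi>) \<sqsubseteq> \<phi> \<^bold>\<and> \<psi>" using F by (simp add: divis)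
  finally show ?thesis .
qed

lemma thm_and_iff: "\<lbrakk>\<phi> \<in> F; \<psi> \<in> F\<rbrakk> \<Longrightarrow> \<turnstile> \<phi> \<^bold>\<and> \<psi> \<longleftrightarrow> (\<turnstile> \<phi>) \<and> (\<turnstile> \<psi>)"
  by (metis Fm_simps(4) and_greatest and_prec1 and_prec2 mp thm_iff)

lemma or_prec1: "\<lbrakk>\<phi> \<in> F; \<psi> \<in> F\<rbrakk> \<Longrightarrow> \<phi> \<sqsubseteq> \<phi> \<^bold>\<or> \<psi>"
  by (simp add: ax A10)

lemma or_prec2: "\<lbrakk>\<phi> \<in> F; \<psi> \<in> F\<rbrakk> \<Longrightarrow> \<psi> \<sqsubseteq> \<phi> \<^bold>\<or> \<psi>"
  by (simp add: ax A11)

lemma or_least: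
  assumes "\<phi> \<sqsubseteq> \<chi>" "\<psi> \<sqsubseteq> \<chi>"
  shows "\<phi> \<^bold>\<or> \<psi> \<sqsubseteq> \<chi>"
proof -
  have F: "\<phi> \<in> F" "\<psi> \<in> F" "\<chi> \<in> F" using assms[THEN thm_Fm] by auto
  show ?thesis by (rule mp[OF ax[OF A12]]) (use assms F in \<open>simp_all add: thm_and_iff\<close>)
qed

lemma and_mono:
  assumes "\<phi> \<sqsubseteq> \<phi>'" "\<psi> \<sqsubseteq> \<psi>'"
  shows "\<phi> \<^bold>\<and> \<psi> \<sqsubseteq> \<phi>' \<^bold>\<and> \<psi>'"
  using assms[THEN thm_Fm]
  by (intro and_greatest prec_trans[OF and_prec1 assms(1)] prec_trans[OF and_prec2 assms(2)]) auto

lemma or_mono: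
  assumes "\<phi> \<sqsubseteq> \<phi>'" "\<psi> \<sqsubseteq> \<psi>'"
  shows "\<phi> \<^bold>\<or> \<psi> \<sqsubseteq> \<phi>' \<^bold>\<or> \<psi>'"
  using assms[THEN thm_Fm]
  by (intro or_least prec_trans[OF assms(1) or_prec1] prec_trans[OF assms(2) or_prec2]) auto

lemma and_prec_iff:
  "\<lbrakk>\<phi> \<in> F; \<psi> \<in> F; \<chi> \<in> F\<rbrakk> \<Longrightarrow> \<chi> \<sqsubseteq> \<phi> \<^bold>\<and> \<psi> \<longleftrightarrow> \<chi> \<sqsubseteq> \<phi> \<and> \<chi> \<sqsubseteq> \<psi>"
  using and_greatest prec_trans[OF _ and_prec1] prec_trans[OF _ and_prec2] by blast

lemma or_prec_iff:
  "\<lbrakk>\<phi> \<in> F; \<psi> \<in> F; \<chi> \<in> F\<rbrakk> \<Longrightarrow> \<phi> \<^bold>\<or> \<psi> \<sqsubseteq> \<chi> \<longleftrightarrow> \<phi> \<sqsubseteq> \<chi> \<and> \<psi> \<sqsubseteq> \<chi>"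
  using or_least prec_trans[OF or_prec1] prec_trans[OF or_prec2] by blast

lemma and_assoc:
  assumes "\<phi> \<in> F" "\<psi> \<in> F" "\<chi> \<in> F"
  shows "(\<phi> \<^bold>\<and> \<psi>) \<^bold>\<and> \<chi> \<sqsubseteq> \<phi> \<^bold>\<and> \<psi> \<^bold>\<and> \<chi>" "\<phi> \<^bold>\<and> \<psi> \<^bold>\<and> \<chi> \<sqsubseteq> (\<phi> \<^bold>\<and> \<psi>) \<^bold>\<and> \<chi>"
proof -
  have "(\<phi> \<^bold>\<and> \<psi>) \<^bold>\<and> \<chi> \<sqsubseteq> \<phi> \<^bold>\<and> \<psi>" "\<phi> \<^bold>\<and> \<psi> \<^bold>\<and> \<chi> \<sqsubseteq> \<psi> \<^bold>\<and> \<chi>"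
    using assms by (simp_all add: and_prec1 and_prec2)
  then show "(\<phi> \<^bold>\<and> \<psi>) \<^bold>\<and> \<chi> \<sqsubseteq> \<phi> \<^bold>\<and> \<psi> \<^bold>\<and> \<chi>" "\<phi> \<^bold>\<and> \<psi> \<^bold>\<and> \<chi> \<sqsubseteq> (\<phi> \<^bold>\<and> \<psi>) \<^bold>\<and> \<chi>"
    using assms by (simp_all add: and_prec_iff and_prec1 and_prec2)
qed

lemma or_assoc:
  assumes "\<phi> \<in> F" "\<psi> \<in> F" "\<chi> \<in> F"
  shows "(\<phi> \<^bold>\<or> \<psi>) \<^bold>\<or> \<chi> \<sqsubseteq> \<phi> \<^bold>\<or> \<psi> \<^bold>\<or> \<chi>" "\<phi> \<^bold>\<or> \<psi> \<^bold>\<or> \<chi> \<sqsubseteq> (\<phi> \<^bold>\<or> \<psi>) \<^bold>\<or> \<chi>"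
proof -
  have "\<phi> \<^bold>\<or> \<psi> \<sqsubseteq> (\<phi> \<^bold>\<or> \<psi>) \<^bold>\<or> \<chi>" "\<chi> \<sqsubseteq> (\<phi> \<^bold>\<or> \<psi>) \<^bold>\<or> \<chi>"
    "\<phi> \<sqsubseteq> \<phi> \<^bold>\<or> \<psi> \<^bold>\<or> \<chi>" "\<psi> \<^bold>\<or> \<chi> \<sqsubseteq> \<phi> \<^bold>\<or> \<psi> \<^bold>\<or> \<chi>"
    using assms by (simp_all add: or_prec1 or_prec2)
  then show "(\<phi> \<^bold>\<or> \<psi>) \<^bold>\<or> \<chi> \<sqsubseteq> \<phi> \<^bold>\<or> \<psi> \<^bold>\<or> \<chi>" "\<phi> \<^bold>\<or> \<psi> \<^bold>\<or> \<chi> \<sqsubseteq> (\<phi> \<^bold>\<or> \<psi>) \<^bold>\<or> \<chi>"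
    using assms by (simp_all add: or_prec_iff)
qed

lemma involutive:
  assumes "\<phi> \<in> F"
  shows "\<^bold>\<not> \<^bold>\<not> \<phi> \<sqsubseteq> \<phi>" "\<phi> \<sqsubseteq> \<^bold>\<not> \<^bold>\<not> \<phi>"
  using ax[OF A15[OF assms]] assms by (simp_all add: thm_and_iff)

text \<open>Necessitation of the implication, distributed by (K).\<close>

lemma box_mono:
  assumes "i \<in> I" "\<phi> \<sqsubseteq> \<psi>"
  shows "Box i \<phi> \<sqsubseteq> Box i \<psi>"
  using mp[OF ax[OF Box_K] derives.Nec[OF assms(2,1)]] assms thm_Fm[OF assms(2)] by simp

section \<open>Equivalence of formulas as a congruence\<close>

definition equivalent (infix "\<simeq>" 50) where
  "\<phi> \<simeq> \<psi> \<longleftrightarrow> \<phi> \<sqsubseteq> \<psi> \<and> \<psi> \<sqsubseteq> \<phi>"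

lemma equivalent_iff_thm: "\<lbrakk>\<phi> \<in> F; \<psi> \<in> F\<rbrakk> \<Longrightarrow> \<phi> \<simeq> \<psi> \<longleftrightarrow> \<turnstile> \<phi> \<^bold>\<leftrightarrow> \<psi>"
  by (simp add: equivalent_def thm_and_iff)

lemma equivalent_refl: "\<phi> \<in> F \<Longrightarrow> \<phi> \<simeq> \<phi>"
  by (simp add: equivalent_def prec_refl)

lemma equivalent_sym: "\<phi> \<simeq> \<psi> \<Longrightarrow> \<psi> \<simeq> \<phi>"
  by (simp add: equivalent_def)

lemma equivalent_trans: "\<phi> \<simeq> \<psi> \<Longrightarrow> \<psi> \<simeq> \<chi> \<Longrightarrow> \<phi> \<simeq> \<chi>"
  by (auto simp: equivalent_def intro: prec_trans)

lemma equivalent_Fm: "\<phi> \<simeq> \<psi> \<Longrightarrow> \<phi> \<in> F \<and> \<psi> \<in> F"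
  by (auto simp: equivalent_def dest: thm_Fm)

lemma equivalent_cong:
  assumes "\<phi> \<simeq> \<phi>'" "\<psi> \<simeq> \<psi>'"
  shows "\<phi> \<^bold>\<and> \<psi> \<simeq> \<phi>' \<^bold>\<and> \<psi>'" "\<phi> \<^bold>\<or> \<psi> \<simeq> \<phi>' \<^bold>\<or> \<psi>'"
    "\<phi> \<^bold>\<cdot> \<psi> \<simeq> \<phi>' \<^bold>\<cdot> \<psi>'" "\<phi> \<^bold>\<rightarrow> \<psi> \<simeq> \<phi>' \<^bold>\<rightarrow> \<psi>'"
  using assms by (simp_all add: equivalent_def and_mono or_mono dot_mono imp_mono)

lemma equivalent_box: "i \<in> I \<Longrightarrow> \<phi> \<simeq> \<psi> \<Longrightarrow> Box i \<phi> \<simeq> Box i \<psi>"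
  by (simp add: equivalent_def box_mono)

end

section \<open>The Lindenbaum algebra inside the universe\<close>

locale lindenbaum = L_theory I Ax \<Gamma>
  for I :: "'i set" and Ax \<Gamma> :: "'i fm set" +
  fixes e :: "'i fm \<Rightarrow> 'a"
  assumes inj: "inj_on e (Fm I)"
begin

text \<open>An equivalence class is coded by the \<open>e\<close>-image of one chosen member, which
  keeps the quotient inside the type \<open>'a\<close>.\<close>

definition cls :: "'i fm \<Rightarrow> 'a" where
  "cls \<phi> = e (SOME \<psi>. \<phi> \<simeq> \<psi>)"

text \<open>A chosen section of \<open>cls\<close>, through which the operations of
  \<open>LT\<close> are defined as total functions on \<open>'a\<close>.\<close>

definition rep :: "'a \<Rightarrow> 'i fm" where
  "rep a = (SOME \<phi>. \<phi> \<in> F \<and> cls \<phi> = a)"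

definition LT :: "('i, 'a) alg" where
  "LT = \<lparr>car = cls ` F,
     meet = \<lambda>a b. cls (rep a \<^bold>\<and> rep b), join = \<lambda>a b. cls (rep a \<^bold>\<or> rep b),
     mul = \<lambda>a b. cls (rep a \<^bold>\<cdot> rep b), imp = \<lambda>a b. cls (rep a \<^bold>\<rightarrow> rep b),
     bot = cls Zero, top = cls One, box = \<lambda>i a. cls (Box i (rep a))\<rparr>"

lemma cls_eq_iff:
  assumes "\<phi> \<in> F" "\<psi> \<in> F"
  shows "cls \<phi> = cls \<psi> \<longleftrightarrow> \<phi> \<simeq> \<psi>"
proof
  have *: "\<chi> \<simeq> (SOME \<psi>. \<chi> \<simeq> \<psi>)" if "\<chi> \<in> F" for \<chi>
    using equivalent_refl[OF that] by (rule someI)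
  assume "cls \<phi> = cls \<psi>"
  \<comment> \<open>Injectivity of \<open>e\<close> recovers the chosen member, which is equivalent
    to both formulas.\<close>
  then have "(SOME \<chi>. \<phi> \<simeq> \<chi>) = (SOME \<chi>. \<psi> \<simeq> \<chi>)"
    unfolding cls_def using inj_onD[OF inj] *[THEN equivalent_Fm] assms by blast
  then show "\<phi> \<simeq> \<psi>" using *[OF assms(1)] *[OF assms(2)]
    by (metis equivalent_sym equivalent_trans)
next
  assume "\<phi> \<simeq> \<psi>"
  \<comment> \<open>Equivalent formulas define the same predicate, so the choice operator picks the
    same member for both.\<close>
  then have "(\<lambda>\<chi>. \<phi> \<simeq> \<chi>) = (\<lambda>\<chi>. \<psi> \<simeq> \<chi>)"
    by (blast intro: equivalent_sym equivalent_trans)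
  then show "cls \<phi> = cls \<psi>" by (simp add: cls_def)
qed

lemma rep_cls:
  assumes "\<phi> \<in> F"
  shows "rep (cls \<phi>) \<in> F" "rep (cls \<phi>) \<simeq> \<phi>"
proof -
  have "rep (cls \<phi>) \<in> F \<and> cls (rep (cls \<phi>)) = cls \<phi>"
    unfolding rep_def by (rule someI[of _ \<phi>]) (simp add: assms)
  then show "rep (cls \<phi>) \<in> F" "rep (cls \<phi>) \<simeq> \<phi>" using assms by (auto simp: cls_eq_iff)
qed

text \<open>Well-definedness of the quotient: \<open>rep\<close> returns an equivalent formula, and
  all connectives respect equivalence.\<close>

lemma LT_simps [simp]:
  "car LT = cls ` F" "alg.bot LT = cls Zero" "alg.top LT = cls One"
  "\<lbrakk>\<phi> \<in> F; \<psi> \<in> F\<rbrakk> \<Longrightarrow> meet LT (cls \<phi>) (cls \<psi>) = cls (\<phi> \<^bold>\<and> \<psi>)"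
  "\<lbrakk>\<phi> \<in> F; \<psi> \<in> F\<rbrakk> \<Longrightarrow> join LT (cls \<phi>) (cls \<psi>) = cls (\<phi> \<^bold>\<or> \<psi>)"
  "\<lbrakk>\<phi> \<in> F; \<psi> \<in> F\<rbrakk> \<Longrightarrow> mul LT (cls \<phi>) (cls \<psi>) = cls (\<phi> \<^bold>\<cdot> \<psi>)"
  "\<lbrakk>\<phi> \<in> F; \<psi> \<in> F\<rbrakk> \<Longrightarrow> imp LT (cls \<phi>) (cls \<psi>) = cls (\<phi> \<^bold>\<rightarrow> \<psi>)"
  "\<lbrakk>i \<in> I; \<phi> \<in> F\<rbrakk> \<Longrightarrow> box LT i (cls \<phi>) = cls (Box i \<phi>)"
  by (simp_all add: LT_def cls_eq_iff equivalent_cong equivalent_box rep_cls)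

lemma le_LT_iff: "\<lbrakk>\<phi> \<in> F; \<psi> \<in> F\<rbrakk> \<Longrightarrow> le LT (cls \<phi>) (cls \<psi>) \<longleftrightarrow> \<phi> \<sqsubseteq> \<psi>"
  by (auto simp: le_def cls_eq_iff equivalent_def
      intro: and_greatest and_prec1 prec_refl prec_trans[OF _ and_prec2])

lemma lang_algebra_LT: "J \<subseteq> I \<Longrightarrow> lang_algebra J LT"
  by (auto simp: lang_algebra_def)

lemma mv_algebra_LT: "mv_algebra LT"
  unfolding mv_algebra_def neg_def
proof (intro conjI)
  show "lang_algebra {} LT" by (simp add: lang_algebra_LT)
next
  show "\<forall>x\<in>car LT. \<forall>y\<in>car LT. \<forall>z\<in>car LT. le LT (mul LT x y) z = le LT x (imp LT y z)"
    by (simp add: le_LT_iff resid)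
qed (simp_all add: le_LT_iff cls_eq_iff equivalent_def dot_comm dot_assoc1 dot_assoc2
    dot_prec1 prec_dot_thm thm_One weaken divis and_assoc or_assoc
    and_greatest or_least and_prec1 and_prec2 or_prec1 or_prec2 prec_refl
    ax A13 A14 involutive)

lemma LT_in_MV: "LT \<in> MV I"
proof -
  \<comment> \<open>Every biconditional axiom becomes an equality of classes; the instances for (M),
    (P), (0) and (1) are the endomorphism conditions.\<close>
  have "cls \<phi> = cls \<psi>" if "\<phi> \<^bold>\<leftrightarrow> \<psi> \<in> L_axioms I" "\<phi> \<in> F" "\<psi> \<in> F" for \<phi> \<psi>
    using ax[OF that(1)] that(2,3) by (simp add: cls_eq_iff equivalent_iff_thm)
  then show ?thesis
    by (simp add: MV_def lang_algebra_LT mv_algebra_LT Box_M Box_P Box_0 Box_1)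
qed

section \<open>Valuations into the Lindenbaum algebra\<close>

lemma eval_LT:
  assumes "range \<sigma> \<subseteq> F" "\<phi> \<in> F"
  shows "eval LT (\<lambda>n. cls (\<sigma> n)) \<phi> = cls (subst \<sigma> \<phi>)"
  using assms(2) by (induction \<phi>) (simp_all add: subst_in_Fm[OF _ assms(1)])

lemma cls_eq_One_iff: "\<phi> \<in> F \<Longrightarrow> cls \<phi> = cls One \<longleftrightarrow> \<turnstile> \<phi>"
  using thm_iff[of \<phi>] weaken[OF thm_One, of \<phi>] by (simp add: cls_eq_iff equivalent_def)

lemma subst_Var: "subst Var \<phi> = \<phi>"
  by (induction \<phi>) simp_all

lemma eval_LT_Var: "\<phi> \<in> F \<Longrightarrow> eval LT (\<lambda>n. cls (Var n)) \<phi> = cls \<phi>"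
  using eval_LT[of Var \<phi>] by (simp add: subst_Var image_subset_iff)

lemma LT_valid:
  assumes "\<alpha> \<in> F" and "\<And>\<sigma>. range \<sigma> \<subseteq> F \<Longrightarrow> \<turnstile> subst \<sigma> \<alpha>"
  shows "eq_conseq {LT} {} (\<alpha>, One)"
proof -
  have "eval LT v \<alpha> = cls One" if v: "range v \<subseteq> cls ` F" for v
  proof -
    \<comment> \<open>Choosing a formula in each class v n presents v as a substitution, so validity
      in \<open>LT\<close> amounts to derivability of all substitution instances.\<close>
    have "\<forall>n. \<exists>\<phi>. \<phi> \<in> F \<and> v n = cls \<phi>" using v by blast
    then obtain \<sigma> where \<sigma>: "\<And>n. \<sigma> n \<in> F" "v = (\<lambda>n. cls (\<sigma> n))" by metis
    then have "range \<sigma> \<subseteq> F" by blast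
    then show ?thesis
      using assms by (simp add: \<sigma>(2) eval_LT subst_in_Fm cls_eq_One_iff)
  qed
  then show ?thesis by (simp add: eq_conseq_def sat_def)
qed

end

section \<open>Uniqueness of the equivalent quasivariety semantics\<close>

lemma semantics_derives_iff:
  assumes "equivalent_algebraic_semantics I C \<tau> \<Delta> K" "\<Gamma> \<subseteq> Fm I" "\<phi> \<in> Fm I"
  shows "C \<Gamma> \<phi> \<longleftrightarrow> (\<forall>d\<in>inst_eqs \<tau> \<phi>. eq_conseq K (\<Union>\<gamma>\<in>\<Gamma>. inst_eqs \<tau> \<gamma>) d)"
  using assms unfolding equivalent_algebraic_semantics_def by simp

lemma semantics_equivalence_valid:
  assumes "equivalent_algebraic_semantics I C \<tau> \<Delta> K" "a \<in> Fm I" "b \<in> Fm I"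
    "\<chi> \<in> inst_fms \<Delta> a b" "d \<in> inst_eqs \<tau> \<chi>"
  shows "eq_conseq K {(a, b)} d"
  using assms unfolding equivalent_algebraic_semantics_def by simp

lemma semantics_equation_from_equivalence:
  assumes "equivalent_algebraic_semantics I C \<tau> \<Delta> K" "a \<in> Fm I" "b \<in> Fm I"
  shows "eq_conseq K (\<Union>\<chi>\<in>inst_fms \<Delta> a b. inst_eqs \<tau> \<chi>) (a, b)"
  using assms unfolding equivalent_algebraic_semantics_def by simp

text \<open>Combines the equivalence formulas of one semantics with the defining equations of the
  other. The formulas \<Delta>(a, a) are theorems, hence their \<tau>'-equations hold in
  \<open>K'\<close>; a valuation that identifies a with b cannot tell \<Delta>(a, a) from
  \<Delta>(a, b).\<close>

lemma sat_inst_eqs_inst_fms: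
  assumes "equivalent_algebraic_semantics I C \<tau> \<Delta> K"
    and "equivalent_algebraic_semantics I C \<tau>' \<Delta>' K'"
    and "A \<in> K'" "range v \<subseteq> car A" "sat A v (a, b)" "a \<in> Fm I" "b \<in> Fm I"
    and "\<delta> \<in> \<Delta>" "d \<in> inst_eqs \<tau>' (subst (\<lambda>n. if n = 0 then a else b) \<delta>)"
  shows "sat A v d"
proof -
  let ?\<sigma> = "\<lambda>b n. if n = (0::nat) then a else b"
  have \<delta>: "\<delta> \<in> Fm I" using assms(1,8)
    by (auto simp: equivalent_algebraic_semantics_def equivalence_formulas_def)
  have aa: "subst (?\<sigma> a) \<delta> \<in> Fm I" using \<delta> assms(6) by (auto intro: subst_in_Fm)
  have "eq_conseq K {} d" if "d \<in> inst_eqs \<tau> (subst (?\<sigma> a) \<delta>)" for d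
  proof -
    have "subst (?\<sigma> a) \<delta> \<in> inst_fms \<Delta> a a" using assms(8) by (auto simp: inst_fms_def)
    then have "eq_conseq K {(a, a)} d"
      using semantics_equivalence_valid[OF assms(1,6,6)] that by blast
    then show ?thesis by (simp add: eq_conseq_def sat_def)
  qed
  then have "C {} (subst (?\<sigma> a) \<delta>)"
    using semantics_derives_iff[OF assms(1) _ aa, of "{}"] by simp
  then have valid: "eq_conseq K' {} d" if "d \<in> inst_eqs \<tau>' (subst (?\<sigma> a) \<delta>)" for d
    using semantics_derives_iff[OF assms(2) _ aa, of "{}"] that by simp
  obtain p q where pq: "(p, q) \<in> \<tau>'"
    and d: "d = (subst (\<lambda>_. subst (?\<sigma> b) \<delta>) p, subst (\<lambda>_. subst (?\<sigma> b) \<delta>) q)"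
    using assms(9) by (auto simp: inst_eqs_def)
  have "sat A v (subst (\<lambda>_. subst (?\<sigma> a) \<delta>) p, subst (\<lambda>_. subst (?\<sigma> a) \<delta>) q)"
    using valid pq assms(3,4) by (force simp: inst_eqs_def eq_conseq_def)
  \<comment> \<open>The two substitutions induce the same valuation, so by \<open>eval_subst\<close>
    the equation passes from the pair (a, a) to (a, b).\<close>
  moreover have "(\<lambda>n. eval A v (?\<sigma> a n)) = (\<lambda>n. eval A v (?\<sigma> b n))"
    using assms(5) by (auto simp: sat_def)
  ultimately show ?thesis by (simp add: d sat_def eval_subst)
qed

text \<open>The common logic mediates. The premises become \<open>\<Gamma>\<close> =
  \<Delta>(\<Theta>); over \<open>K\<close> these yield every formula in \<Delta>'(\<phi>, \<psi>),
  hence they do so in the logic, and reading this off in \<open>K'\<close> gives back \<phi>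
  \<approx> \<psi>.\<close>

lemma eq_conseq_transfer:
  assumes K: "equivalent_algebraic_semantics I C \<tau> \<Delta> K"
    and K': "equivalent_algebraic_semantics I C \<tau>' \<Delta>' K'"
    and "\<Theta> \<subseteq> Fm I \<times> Fm I" "e \<in> Fm I \<times> Fm I" and conseq: "eq_conseq K \<Theta> e"
  shows "eq_conseq K' \<Theta> e"
  unfolding eq_conseq_def
proof (intro ballI allI impI)
  fix A v
  assume A: "A \<in> K'" and v: "range v \<subseteq> car A" and sat: "\<forall>d\<in>\<Theta>. sat A v d"
  obtain \<phi> \<psi> where e: "e = (\<phi>, \<psi>)" by (cases e)
  have F: "\<phi> \<in> Fm I" "\<psi> \<in> Fm I" using assms(4) e by auto
  let ?\<sigma> = "\<lambda>a b n. if n = (0::nat) then a else b"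
  define \<Gamma> where "\<Gamma> = (\<Union>(a, b)\<in>\<Theta>. inst_fms \<Delta> a b)"
  have \<Delta>: "\<Delta> \<subseteq> Fm I" "\<Delta>' \<subseteq> Fm I" using K K'
    by (auto simp: equivalent_algebraic_semantics_def equivalence_formulas_def)
  have inst: "subst (?\<sigma> a b) \<delta> \<in> Fm I" if "a \<in> Fm I" "b \<in> Fm I" "\<delta> \<in> Fm I" for a b \<delta>
    using that by (auto intro: subst_in_Fm)
  have \<Gamma>: "\<Gamma> \<subseteq> Fm I"
    using assms(3) \<Delta> by (auto simp: \<Gamma>_def inst_fms_def intro!: inst)
  \<comment> \<open>The given valuation in \<open>A\<close> satisfies \<Theta>, so it also satisfies
    the \<tau>'-translation of \<open>\<Gamma>\<close>.\<close>
  have \<Gamma>_sat: "sat A v d" if "\<gamma> \<in> \<Gamma>" "d \<in> inst_eqs \<tau>' \<gamma>" for \<gamma> d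
  proof -
    obtain a b \<delta> where "(a, b) \<in> \<Theta>" "\<delta> \<in> \<Delta>" "\<gamma> = subst (?\<sigma> a b) \<delta>"
      using \<open>\<gamma> \<in> \<Gamma>\<close> by (auto simp: \<Gamma>_def inst_fms_def)
    then show ?thesis
      using sat_inst_eqs_inst_fms[OF K K' A v] sat assms(3) that(2) by blast
  qed
  have "sat A v d" if \<chi>: "\<chi> \<in> inst_fms \<Delta>' \<phi> \<psi>" and d: "d \<in> inst_eqs \<tau>' \<chi>" for \<chi> d
  proof -
    obtain \<delta> where \<delta>: "\<delta> \<in> \<Delta>'" "\<chi> = subst (?\<sigma> \<phi> \<psi>) \<delta>" using \<chi> by (auto simp: inst_fms_def)
    then have \<chi>F: "\<chi> \<in> Fm I" using inst F \<Delta>(2) by blast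
    \<comment> \<open>Inside \<open>K\<close> the \<tau>-translation of \<open>\<Gamma>\<close>
      gives back \<Theta>; the assumed consequence then applies.\<close>
    have "eq_conseq K (\<Union>\<gamma>\<in>\<Gamma>. inst_eqs \<tau> \<gamma>) c" if c: "c \<in> inst_eqs \<tau> \<chi>" for c
      unfolding eq_conseq_def
    proof (intro ballI allI impI)
      fix B w
      assume B: "B \<in> K" and w: "range w \<subseteq> car B" and \<Gamma>_sat: "\<forall>d\<in>\<Union>\<gamma>\<in>\<Gamma>. inst_eqs \<tau> \<gamma>. sat B w d"
      have "sat B w (a, b)" if ab: "(a, b) \<in> \<Theta>" for a b
      proof -
        have "eq_conseq K (\<Union>\<chi>\<in>inst_fms \<Delta> a b. inst_eqs \<tau> \<chi>) (a, b)"
          using ab assms(3) by (intro semantics_equation_from_equivalence[OF K]) auto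
        moreover have "\<forall>d\<in>\<Union>\<chi>\<in>inst_fms \<Delta> a b. inst_eqs \<tau> \<chi>. sat B w d"
          using \<Gamma>_sat ab unfolding \<Gamma>_def by blast
        ultimately show ?thesis using B w unfolding eq_conseq_def by blast
      qed
      then have "\<forall>d\<in>\<Theta>. sat B w d" by auto
      then have "sat B w (\<phi>, \<psi>)" using conseq B w unfolding eq_conseq_def e by blast
      \<comment> \<open>The mixing lemma with the roles exchanged: \<Delta>' is now paired with
        \<tau>.\<close>
      then show "sat B w c"
        using sat_inst_eqs_inst_fms[OF K' K B w _ F \<delta>(1)] c \<delta>(2) by blast
    qed
    then have "C \<Gamma> \<chi>"
      by (simp add: semantics_derives_iff[OF K \<Gamma> \<chi>F])
    then have "eq_conseq K' (\<Union>\<gamma>\<in>\<Gamma>. inst_eqs \<tau>' \<gamma>) d"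
      using d by (simp add: semantics_derives_iff[OF K' \<Gamma> \<chi>F])
    then show ?thesis using A v \<Gamma>_sat unfolding eq_conseq_def by blast
  qed
  moreover have "eq_conseq K' (\<Union>\<chi>\<in>inst_fms \<Delta>' \<phi> \<psi>. inst_eqs \<tau>' \<chi>) (\<phi>, \<psi>)"
    by (rule semantics_equation_from_equivalence[OF K' F])
  ultimately show "sat A v e" using A v unfolding eq_conseq_def e by blast
qed

text \<open>Each quasi-equation defining \<open>K'\<close> holds throughout \<open>K'\<close> and is
  therefore transferred to \<open>K\<close>.\<close>

lemma quasivariety_semantics_subset:
  assumes K: "equivalent_algebraic_semantics I C \<tau> \<Delta> K"
    and K': "equivalent_algebraic_semantics I C \<tau>' \<Delta>' K'" and "quasivariety I K'"
  shows "K \<subseteq> K'"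
proof
  fix A assume A: "A \<in> K"
  obtain Q where Q: "\<forall>(\<Theta>, e)\<in>Q. finite \<Theta> \<and> \<Theta> \<subseteq> Fm I \<times> Fm I \<and> e \<in> Fm I \<times> Fm I"
    and K'_eq: "K' = {A. lang_algebra I A \<and> (\<forall>(\<Theta>, e)\<in>Q. eq_conseq {A} \<Theta> e)}"
    using assms(3) unfolding quasivariety_def by (elim exE conjE)
  have "eq_conseq {A} \<Theta> e" if "(\<Theta>, e) \<in> Q" for \<Theta> e
  proof -
    have "eq_conseq {B} \<Theta> e" if "B \<in> K'" for B
      using that \<open>(\<Theta>, e) \<in> Q\<close> unfolding K'_eq by blast
    then have "eq_conseq K' \<Theta> e" unfolding eq_conseq_def by blast
    moreover have "\<Theta> \<subseteq> Fm I \<times> Fm I" "e \<in> Fm I \<times> Fm I" using Q that by auto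
    ultimately have "eq_conseq K \<Theta> e" by (intro eq_conseq_transfer[OF K' K])
    then show ?thesis using A by (simp add: eq_conseq_def)
  qed
  moreover have "lang_algebra I A" using K A by (simp add: equivalent_algebraic_semantics_def)
  ultimately show "A \<in> K'" unfolding K'_eq by blast
qed

lemma variety_imp_quasivariety: "variety I K \<Longrightarrow> quasivariety I K"
proof -
  assume "variety I K"
  then obtain E where "E \<subseteq> Fm I \<times> Fm I"
    and "K = {A. lang_algebra I A \<and> (\<forall>e\<in>E. eq_conseq {A} {} e)}"
    unfolding variety_def by (elim exE conjE)
  then show ?thesis
    unfolding quasivariety_def by (intro exI[of _ "Pair {} ` E"]) auto
qed

lemma equivalent_variety_semanticsI:
  assumes "variety I K" "equivalent_algebraic_semantics I C \<tau> \<Delta> K"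
  shows "equivalent_variety_semantics I C \<tau> \<Delta> K"
  unfolding equivalent_variety_semantics_def
  using assms quasivariety_semantics_subset[OF assms(2)]
    quasivariety_semantics_subset[OF _ assms(2) variety_imp_quasivariety[OF assms(1)]]
  by (intro conjI allI impI equalityI; (elim conjE)?) metis+

section \<open>The variety of MV(I)-algebras\<close>

context mv
begin

text \<open>The unit of the adjunction between \<odot> and \<leadsto> with z joined on: an
  inequality free of premises, hence expressible as an equation.\<close>

lemma le_imp_mul_join: "\<lbrakk>x \<in> C; y \<in> C; z \<in> C\<rbrakk> \<Longrightarrow> x \<preceq> y \<leadsto> ((x \<odot> y) \<squnion> z)"
  by (simp add: residuation[symmetric])

text \<open>Multiplication by z has a right adjoint and so preserves joins.\<close>

lemma mul_join_distrib:
  assumes "x \<in> C" "y \<in> C" "z \<in> C"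
  shows "(x \<squnion> y) \<odot> z = (x \<odot> z) \<squnion> (y \<odot> z)"
proof (rule le_antisym)
  show "(x \<squnion> y) \<odot> z \<preceq> (x \<odot> z) \<squnion> (y \<odot> z)"
    unfolding residuation[OF closed(4)[OF assms(1,2)] assms(3) closed(4)[OF closed(5)[OF assms(1,3)] closed(5)[OF assms(2,3)]]]
    by (rule join_least) (use assms in \<open>simp_all add: residuation[symmetric]\<close>)
  show "(x \<odot> z) \<squnion> (y \<odot> z) \<preceq> (x \<squnion> y) \<odot> z"
    using assms by (simp add: join_least mul_mono)
qed (use assms in simp_all)

end

text \<open>Among the defining conditions only residuation is not an equation. It is replaced by
  \<open>x \<le> y \<rightarrow> (x \<cdot> y \<or> z)\<close> and \<open>(x \<or> y) \<cdot> z = x \<cdot> z \<or> y \<cdot> z\<close>.\<close>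

lemma residuation_from_equations:
  fixes A :: "('i, 'a) alg"
  assumes "lang_algebra {} A" and x: "x \<in> car A" and y: "y \<in> car A" and z: "z \<in> car A"
    and meet_comm: "\<And>x y. \<lbrakk>x \<in> car A; y \<in> car A\<rbrakk> \<Longrightarrow> meet A x y = meet A y x"
    and join_comm: "\<And>x y. \<lbrakk>x \<in> car A; y \<in> car A\<rbrakk> \<Longrightarrow> join A x y = join A y x"
    and meet_assoc: "\<And>x y z. \<lbrakk>x \<in> car A; y \<in> car A; z \<in> car A\<rbrakk> \<Longrightarrow>
      meet A (meet A x y) z = meet A x (meet A y z)"
    and meet_join: "\<And>x y. \<lbrakk>x \<in> car A; y \<in> car A\<rbrakk> \<Longrightarrow> meet A x (join A x y) = x"
    and join_meet: "\<And>x y. \<lbrakk>x \<in> car A; y \<in> car A\<rbrakk> \<Longrightarrow> join A x (meet A x y) = x"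
    and mul_comm: "\<And>x y. \<lbrakk>x \<in> car A; y \<in> car A\<rbrakk> \<Longrightarrow> mul A x y = mul A y x"
    and divisible: "\<And>x y. \<lbrakk>x \<in> car A; y \<in> car A\<rbrakk> \<Longrightarrow> mul A x (imp A x y) = meet A x y"
    and imp_mul_join: "\<And>x y z. \<lbrakk>x \<in> car A; y \<in> car A; z \<in> car A\<rbrakk> \<Longrightarrow>
      meet A x (imp A y (join A (mul A x y) z)) = x"
    and mul_join: "\<And>x y z. \<lbrakk>x \<in> car A; y \<in> car A; z \<in> car A\<rbrakk> \<Longrightarrow>
      mul A (join A x y) z = join A (mul A x z) (mul A y z)"
  shows "le A (mul A x y) z \<longleftrightarrow> le A x (imp A y z)"
proof -
  note [simp] = x y z
  have closed [simp]: "meet A u w \<in> car A" "join A u w \<in> car A" "mul A u w \<in> car A" "imp A u w \<in> car A"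
    if "u \<in> car A" "w \<in> car A" for u w
    using assms(1) that unfolding lang_algebra_def by blast+
  have le_iff_join: "le A u w \<longleftrightarrow> join A u w = w" if "u \<in> car A" "w \<in> car A" for u w
    using that by (metis join_comm join_meet le_def meet_comm meet_join)
  show ?thesis
  proof
    assume "le A (mul A x y) z"
    then have "join A (mul A x y) z = z" by (simp add: le_iff_join)
    then show "le A x (imp A y z)" using imp_mul_join[of x y z] by (simp add: le_def)
  next
    assume "le A x (imp A y z)"
    \<comment> \<open>From x \<squnion> (y \<leadsto> z) = y \<leadsto> z, distributivity yields x
      \<odot> y \<preceq> (y \<leadsto> z) \<odot> y, and divisibility identifies the bound with y
      \<sqinter> z.\<close>
    then have "join A (mul A x y) (mul A (imp A y z) y) = mul A (imp A y z) y"
      using mul_join[of x "imp A y z" y] by (simp add: le_iff_join)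
    moreover have "mul A (imp A y z) y = meet A y z"
      using divisible[of y z] mul_comm[of "imp A y z" y] by simp
    ultimately have "le A (mul A x y) (meet A y z)" by (simp add: le_iff_join)
    then have xy: "meet A (mul A x y) (meet A y z) = mul A x y" by (simp add: le_def)
    have "meet A z z = z" using meet_join[of z "meet A z z"] by (simp add: join_meet)
    then have "meet A (meet A (mul A x y) (meet A y z)) z = meet A (mul A x y) (meet A y z)"
      by (simp add: meet_assoc)
    then show "le A (mul A x y) z" by (simp add: xy le_def)
  qed
qed

text \<open>The axiomatization is the full equational theory of the class. Each defining identity is
  verified in MV(I)-algebras and thereby available in any model of that theory; residuation is then
  rebuilt from identities.\<close>

lemma variety_MV: "variety I (MV I :: ('i, 'a) alg set)"
proof -
  define E :: "'i eqn set" where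
    "E = {d \<in> Fm I \<times> Fm I. eq_conseq (MV I :: ('i, 'a) alg set) {} d}"
  have "A \<in> MV I" if lang: "lang_algebra I A" and A: "\<forall>d\<in>E. eq_conseq {A} {} d" for A :: "('i, 'a) alg"
  proof -
    \<comment> \<open>Three elements suffice for the identities below; the third is also the value
      of all remaining variables.\<close>
    define val :: "'a \<Rightarrow> 'a \<Rightarrow> 'a \<Rightarrow> nat \<Rightarrow> 'a" where
      "val x y z n = (if n = 0 then x else if n = 1 then y else z)" for x y z n
    have val [simp]: "val x y z 0 = x" "val x y z (Suc 0) = y" "val x y z 2 = z" for x y z
      by (simp_all add: val_def)
    have eq: "eval A (val x y z) \<phi> = eval A (val x y z) \<psi>"
      if valid: "\<And>(B :: ('i, 'a) alg) v. B \<in> MV I \<Longrightarrow> mv B \<Longrightarrow> (\<And>n. v n \<in> car B) \<Longrightarrow> eval B v \<phi> = eval B v \<psi>"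
        and "\<phi> \<in> Fm I" "\<psi> \<in> Fm I" "x \<in> car A" "y \<in> car A" "z \<in> car A" for \<phi> \<psi> x y z
    proof -
      have "eval B v \<phi> = eval B v \<psi>" if "B \<in> MV I" "range v \<subseteq> car B" for B :: "('i, 'a) alg" and v
        by (rule valid[OF that(1) MV_mv[OF that(1)]]) (use that(2) in blast)
      then have "(\<phi>, \<psi>) \<in> E" using that(2,3) by (simp add: E_def eq_conseq_def sat_def)
      then have "eq_conseq {A} {} (\<phi>, \<psi>)" using A by blast
      moreover have "range (val x y z) \<subseteq> car A" using that(4-6) by (auto simp: val_def)
      ultimately show ?thesis by (simp add: eq_conseq_def sat_def)
    qed
    let ?x = "Var 0 :: 'i fm" and ?y = "Var 1 :: 'i fm" and ?z = "Var 2 :: 'i fm"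
    have meet_comm: "meet A x y = meet A y x" if "x \<in> car A" "y \<in> car A" for x y
      using eq[of "?x \<^bold>\<and> ?y" "?y \<^bold>\<and> ?x" x y x] that by (simp add: mv.meet_comm)
    have join_comm: "join A x y = join A y x" if "x \<in> car A" "y \<in> car A" for x y
      using eq[of "?x \<^bold>\<or> ?y" "?y \<^bold>\<or> ?x" x y x] that by (simp add: mv.join_comm)
    have meet_assoc: "meet A (meet A x y) z = meet A x (meet A y z)"
      if "x \<in> car A" "y \<in> car A" "z \<in> car A" for x y z
      using eq[of "(?x \<^bold>\<and> ?y) \<^bold>\<and> ?z" "?x \<^bold>\<and> ?y \<^bold>\<and> ?z" x y z] that by (simp add: mv.meet_assoc)
    have join_assoc: "join A (join A x y) z = join A x (join A y z)"
      if "x \<in> car A" "y \<in> car A" "z \<in> car A" for x y z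
      using eq[of "(?x \<^bold>\<or> ?y) \<^bold>\<or> ?z" "?x \<^bold>\<or> ?y \<^bold>\<or> ?z" x y z] that by (simp add: mv.join_assoc)
    have meet_join: "meet A x (join A x y) = x" if "x \<in> car A" "y \<in> car A" for x y
      using eq[of "?x \<^bold>\<and> (?x \<^bold>\<or> ?y)" ?x x y x] that by (simp add: mv.meet_join)
    have join_meet: "join A x (meet A x y) = x" if "x \<in> car A" "y \<in> car A" for x y
      using eq[of "?x \<^bold>\<or> (?x \<^bold>\<and> ?y)" ?x x y x] that by (simp add: mv.join_meet)
    have bot_le: "le A (alg.bot A) x" if "x \<in> car A" for x
      using eq[of "Zero \<^bold>\<and> ?x" Zero x x x] that by (simp add: mv.bot_le[unfolded le_def] le_def)
    have le_top: "le A x (alg.top A)" if "x \<in> car A" for x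
      using eq[of "?x \<^bold>\<and> One" ?x x x x] that by (simp add: mv.le_top[unfolded le_def] le_def)
    have mul_comm: "mul A x y = mul A y x" if "x \<in> car A" "y \<in> car A" for x y
      using eq[of "?x \<^bold>\<cdot> ?y" "?y \<^bold>\<cdot> ?x" x y x] that by (simp add: mv.mul_comm)
    have mul_assoc: "mul A (mul A x y) z = mul A x (mul A y z)"
      if "x \<in> car A" "y \<in> car A" "z \<in> car A" for x y z
      using eq[of "(?x \<^bold>\<cdot> ?y) \<^bold>\<cdot> ?z" "?x \<^bold>\<cdot> ?y \<^bold>\<cdot> ?z" x y z] that by (simp add: mv.mul_assoc)
    have mul_top: "mul A x (alg.top A) = x" if "x \<in> car A" for x
      using eq[of "?x \<^bold>\<cdot> One" ?x x x x] that by (simp add: mv.mul_top)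
    have divisible: "mul A x (imp A x y) = meet A x y" if "x \<in> car A" "y \<in> car A" for x y
      using eq[of "?x \<^bold>\<cdot> (?x \<^bold>\<rightarrow> ?y)" "?x \<^bold>\<and> ?y" x y x] that by (simp add: mv.divisible)
    have prelinear: "join A (imp A x y) (imp A y x) = alg.top A" if "x \<in> car A" "y \<in> car A" for x y
      using eq[of "(?x \<^bold>\<rightarrow> ?y) \<^bold>\<or> (?y \<^bold>\<rightarrow> ?x)" One x y x] that by (simp add: mv.prelinear)
    have neg_neg: "neg A (neg A x) = x" if "x \<in> car A" for x
      using eq[of "\<^bold>\<not> \<^bold>\<not> ?x" ?x x x x] that by (simp add: mv.neg_neg[unfolded neg_def] neg_def)
    have imp_mul_join: "meet A x (imp A y (join A (mul A x y) z)) = x"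
      if "x \<in> car A" "y \<in> car A" "z \<in> car A" for x y z
      using eq[of "?x \<^bold>\<and> (?y \<^bold>\<rightarrow> (?x \<^bold>\<cdot> ?y) \<^bold>\<or> ?z)" ?x x y z] that
      by (simp add: mv.le_imp_mul_join[unfolded le_def])
    have mul_join: "mul A (join A x y) z = join A (mul A x z) (mul A y z)"
      if "x \<in> car A" "y \<in> car A" "z \<in> car A" for x y z
      using eq[of "(?x \<^bold>\<or> ?y) \<^bold>\<cdot> ?z" "(?x \<^bold>\<cdot> ?z) \<^bold>\<or> (?y \<^bold>\<cdot> ?z)" x y z] that
      by (simp add: mv.mul_join_distrib)
    have lang0: "lang_algebra {} A" using lang by (simp add: lang_algebra_def)
    have resid: "le A (mul A x y) z \<longleftrightarrow> le A x (imp A y z)"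
      if "x \<in> car A" "y \<in> car A" "z \<in> car A" for x y z
      by (rule residuation_from_equations[OF lang0 that meet_comm join_comm meet_assoc meet_join
          join_meet mul_comm divisible imp_mul_join mul_join])
    have "mv_algebra A"
      unfolding mv_algebra_def
      by (intro conjI ballI; rule lang0 meet_comm join_comm meet_assoc join_assoc meet_join
          join_meet bot_le le_top mul_comm mul_assoc mul_top resid divisible prelinear neg_neg)
    moreover have "box A i (meet A x y) = meet A (box A i x) (box A i y)"
      "box A i (mul A x y) = mul A (box A i x) (box A i y)"
      "box A i (alg.bot A) = alg.bot A" "box A i (alg.top A) = alg.top A"
      if "i \<in> I" "x \<in> car A" "y \<in> car A" for i x y
      using eq[of "Box i (?x \<^bold>\<and> ?y)" "Box i ?x \<^bold>\<and> Box i ?y" x y x]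
        eq[of "Box i (?x \<^bold>\<cdot> ?y)" "Box i ?x \<^bold>\<cdot> Box i ?y" x y x]
        eq[of "Box i Zero" "Zero" x y x] eq[of "Box i One" "One" x y x] that
      by (simp_all add: MV_def)
    \<comment> \<open>An element of the carrier, with which the x and y in the statements about the
      constants can be instantiated.\<close>
    moreover have "alg.bot A \<in> car A" using lang by (simp add: lang_algebra_def)
    ultimately show ?thesis using lang unfolding MV_def by (simp add: lang0)
  qed
  moreover have "lang_algebra I A \<and> (\<forall>d\<in>E. eq_conseq {A} {} d)" if "A \<in> MV I" for A :: "('i, 'a) alg"
    using that by (auto simp: E_def eq_conseq_def MV_lang_algebra)
  ultimately have "MV I = {A :: ('i, 'a) alg. lang_algebra I A \<and> (\<forall>d\<in>E. eq_conseq {A} {} d)}"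
    by (intro equalityI subsetI) simp_all
  moreover have "E \<subseteq> Fm I \<times> Fm I" by (auto simp: E_def)
  ultimately show ?thesis unfolding variety_def by (intro exI[of _ E] conjI)
qed

section \<open>Axiomatic extensions\<close>

lemma inst_eqs_one_eq [simp]: "inst_eqs one_eq \<phi> = {(\<phi>, One)}"
  by (simp add: inst_eqs_def one_eq_def)

lemma inst_fms_iff_fm [simp]: "inst_fms iff_fm \<phi> \<psi> = {\<phi> \<^bold>\<leftrightarrow> \<psi>}"
  by (simp add: inst_fms_def iff_fm_def)

text \<open>One valuation is kept fixed throughout. Detachment preserves the value top because
  \<one> \<preceq> y forces y = \<one>, and necessitation because each box fixes top.\<close>

lemma derives_sound:
  assumes "derives I Ax \<Gamma> \<phi>" "Ax \<subseteq> Fm I" "\<Gamma> \<subseteq> Fm I" and A: "A \<in> MV I" and v: "range v \<subseteq> car A"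
    and "\<And>\<alpha>. \<alpha> \<in> Ax \<union> \<Gamma> \<Longrightarrow> eval A v \<alpha> = alg.top A"
  shows "eval A v \<phi> = alg.top A"
  using assms(1)
proof induction
  case (MP \<phi> \<psi>)
  interpret mv A using A by (rule MV_mv)
  have "\<phi> \<^bold>\<rightarrow> \<psi> \<in> Fm I" by (rule derives_in_Fm[OF MP.hyps(2) assms(2,3)])
  then have car: "eval A v \<psi> \<in> car A" using eval_in_car[OF MV_lang_algebra[OF A] v] by simp
  then show ?case using MP.IH imp_eq_top_iff[of "alg.top A" "eval A v \<psi>"]
    by (auto intro: le_antisym)
next
  case (Nec \<phi> i)
  then show ?case using A by (simp add: MV_def)
qed (use assms(6) in auto)

text \<open>Adding identities keeps the class a variety. Soundness holds valuation by valuation;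
  completeness is tested on the Lindenbaum algebra of the premises, which belongs to the class
  because \<open>X\<close> is closed under substitution.\<close>

theorem equivalent_variety_semantics_extension:
  fixes e :: "'i fm \<Rightarrow> 'a"
  assumes inj: "inj_on e (Fm I)" and X: "X \<subseteq> Fm I"
    and subst: "\<And>\<sigma> \<alpha>. range \<sigma> \<subseteq> Fm I \<Longrightarrow> \<alpha> \<in> X \<Longrightarrow> subst \<sigma> \<alpha> \<in> X"
  shows "equivalent_variety_semantics I (derives I (insert One (L_axioms I \<union> X))) one_eq iff_fm
    {A \<in> MV I :: ('i, 'a) alg set. \<forall>\<alpha>\<in>X. eq_conseq {A} {} (\<alpha>, One)}"
    (is "equivalent_variety_semantics I (derives I ?Ax) _ _ ?K")
proof (rule equivalent_variety_semanticsI)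
  obtain E where E: "E \<subseteq> Fm I \<times> Fm I"
    and MV: "MV I = {A :: ('i, 'a) alg. lang_algebra I A \<and> (\<forall>d\<in>E. eq_conseq {A} {} d)}"
    using variety_MV[of I, where 'a = 'a] unfolding variety_def by (elim exE conjE)
  let ?E = "E \<union> (\<lambda>\<alpha>. (\<alpha>, One)) ` X"
  have "?E \<subseteq> Fm I \<times> Fm I" using E X by auto
  moreover have "?K = {A. lang_algebra I A \<and> (\<forall>d\<in>?E. eq_conseq {A} {} d)}"
    unfolding MV by (simp add: ball_Un)
  ultimately show "variety I ?K"
    unfolding variety_def by (intro exI[of _ ?E] conjI)
  have Ax: "?Ax \<subseteq> Fm I" using X L_axioms_subset_Fm[of I] by simp
  have "deductive_system I (derives I ?Ax)"
    by (rule deductive_system_derives) (auto intro: subst subst_L_axioms)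
  moreover have "defining_equations I one_eq" "equivalence_formulas I iff_fm"
    by (simp_all add: defining_equations_def equivalence_formulas_def one_eq_def iff_fm_def)
  moreover have "derives I ?Ax \<Gamma> \<phi> \<longleftrightarrow> eq_conseq ?K (\<Union>\<gamma>\<in>\<Gamma>. {(\<gamma>, One)}) (\<phi>, One)"
    if \<Gamma>: "\<Gamma> \<subseteq> Fm I" and \<phi>: "\<phi> \<in> Fm I" for \<Gamma> \<phi>
  proof
    assume "derives I ?Ax \<Gamma> \<phi>"
    then have "eval A v \<phi> = alg.top A"
      if "A \<in> ?K" "range v \<subseteq> car A" "\<forall>\<gamma>\<in>\<Gamma>. eval A v \<gamma> = alg.top A" for v and A :: "('i, 'a) alg"
    proof (rule derives_sound[OF _ Ax \<Gamma>])
      fix \<alpha> assume "\<alpha> \<in> ?Ax \<union> \<Gamma>"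
      then show "eval A v \<alpha> = alg.top A"
        using that by (auto simp: eq_conseq_def sat_def L_axioms_valid)
    qed (use that in auto)
    then show "eq_conseq ?K (\<Union>\<gamma>\<in>\<Gamma>. {(\<gamma>, One)}) (\<phi>, One)"
      by (simp add: eq_conseq_def sat_def)
  next
    assume conseq: "eq_conseq ?K (\<Union>\<gamma>\<in>\<Gamma>. {(\<gamma>, One)}) (\<phi>, One)"
    interpret lindenbaum I ?Ax \<Gamma> e
      by unfold_locales (use inj Ax \<Gamma> in auto)
    have "LT \<in> ?K"
      using LT_in_MV X by (auto intro!: LT_valid derives.Ax subst)
    \<comment> \<open>The canonical valuation sends each formula to its own class, so exactly the
      consequences of \<open>\<Gamma>\<close> take the value top.\<close>
    moreover have "range (\<lambda>n. cls (Var n)) \<subseteq> car LT" by auto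
    moreover have "\<forall>d\<in>\<Union>\<gamma>\<in>\<Gamma>. {(\<gamma>, One)}. sat LT (\<lambda>n. cls (Var n)) d"
      using \<Gamma> by (auto simp: sat_def eval_LT_Var cls_eq_One_iff intro!: derives.Hyp)
    ultimately have "sat LT (\<lambda>n. cls (Var n)) (\<phi>, One)"
      using conseq unfolding eq_conseq_def by blast
    then show "derives I ?Ax \<Gamma> \<phi>" using \<phi> by (simp add: sat_def eval_LT_Var cls_eq_One_iff)
  qed
  \<comment> \<open>Valuation by valuation the two equations mean the same, which gives both halves
    of the clause on equivalence formulas.\<close>
  moreover have "sat A v (\<phi> \<^bold>\<leftrightarrow> \<psi>, One) \<longleftrightarrow> sat A v (\<phi>, \<psi>)"
    if "\<phi> \<in> Fm I" "\<psi> \<in> Fm I" "A \<in> ?K" "range v \<subseteq> car A" for \<phi> \<psi> v and A :: "('i, 'a) alg"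
    using that mv.iff_eq_top_iff[OF MV_mv, of A I] eval_in_car[OF MV_lang_algebra, of A I v]
    by (simp add: sat_def)
  ultimately show "equivalent_algebraic_semantics I (derives I ?Ax) one_eq iff_fm ?K"
    unfolding equivalent_algebraic_semantics_def
    by (simp add: MV_lang_algebra eq_conseq_def)
qed

section \<open>The S4 and tense cases\<close>

lemma valid_imp_iff:
  assumes "A \<in> MV I" "\<phi> \<in> Fm I" "\<psi> \<in> Fm I"
  shows "eq_conseq {A} {} (\<phi> \<^bold>\<rightarrow> \<psi>, One) \<longleftrightarrow>
    (\<forall>v. range v \<subseteq> car A \<longrightarrow> le A (eval A v \<phi>) (eval A v \<psi>))"
  using assms(2,3)
  by (simp add: eq_conseq_def sat_def mv.imp_eq_top_iff[OF MV_mv[OF assms(1)]]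
      eval_in_car[OF MV_lang_algebra[OF assms(1)]])

text \<open>The axioms added to those of \<open>L I\<close>, isolated to play the role of
  \<open>X\<close> in the extension theorem.\<close>

definition S4_schemes :: "'i set \<Rightarrow> 'i fm set" where
  "S4_schemes I = {Box i \<phi> \<^bold>\<rightarrow> \<phi> | i \<phi>. i \<in> I \<and> \<phi> \<in> Fm I}
     \<union> {Box i \<phi> \<^bold>\<rightarrow> Box i (Box i \<phi>) | i \<phi>. i \<in> I \<and> \<phi> \<in> Fm I}"

definition tense_schemes :: "tense_conn fm set" where
  "tense_schemes = {\<phi> \<^bold>\<rightarrow> Box G (\<^bold>\<not> Box H (\<^bold>\<not> \<phi>)) | \<phi>. \<phi> \<in> Fm {G, H}}
     \<union> {\<phi> \<^bold>\<rightarrow> Box H (\<^bold>\<not> Box G (\<^bold>\<not> \<phi>)) | \<phi>. \<phi> \<in> Fm {G, H}}"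

text \<open>(T) says that a box is deflationary, and with (4) antisymmetry gives idempotence.
  Monotonicity comes from preservation of meets.\<close>

lemma S4MV_I_eq: "S4MV_I I = {A \<in> MV I. \<forall>\<alpha>\<in>S4_schemes I. eq_conseq {A} {} (\<alpha>, One)}"
proof -
  have "(\<forall>i\<in>I. interior_operator A (box A i)) \<longleftrightarrow> (\<forall>\<alpha>\<in>S4_schemes I. eq_conseq {A} {} (\<alpha>, One))"
    if A: "A \<in> MV I" for A
  proof -
    interpret mv A using A by (rule MV_mv)
    note car = eval_in_car[OF MV_lang_algebra[OF A]]
    have box: "box A i x \<in> car A" if "i \<in> I" "x \<in> car A" for i x
      using A that by (simp add: MV_def lang_algebra_def)
    show ?thesis
    proof
      assume "\<forall>i\<in>I. interior_operator A (box A i)"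
      then show "\<forall>\<alpha>\<in>S4_schemes I. eq_conseq {A} {} (\<alpha>, One)"
        by (auto simp: S4_schemes_def valid_imp_iff[OF A] interior_operator_def car box)
    next
      assume valid: "\<forall>\<alpha>\<in>S4_schemes I. eq_conseq {A} {} (\<alpha>, One)"
      have T4: "le A (box A i x) x \<and> le A (box A i x) (box A i (box A i x))"
        if "i \<in> I" "x \<in> car A" for i x
      proof -
        have "Box i (Var 0) \<^bold>\<rightarrow> Var 0 \<in> S4_schemes I"
          "Box i (Var 0) \<^bold>\<rightarrow> Box i (Box i (Var 0)) \<in> S4_schemes I"
          using that by (auto simp: S4_schemes_def)
        then have "eq_conseq {A} {} (Box i (Var 0) \<^bold>\<rightarrow> Var 0, One)"
          "eq_conseq {A} {} (Box i (Var 0) \<^bold>\<rightarrow> Box i (Box i (Var 0)), One)" using valid by blast+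
        then show ?thesis
          \<comment> \<open>The constant valuation at x turns the scheme instances for
            \<open>Var 0\<close> into inequalities about x.\<close>
          using that by (auto simp: valid_imp_iff[OF A] dest!: spec[of _ "\<lambda>_. x"])
      qed
      show "\<forall>i\<in>I. interior_operator A (box A i)"
        unfolding interior_operator_def by (simp add: T4 MV_box_mono[OF A] box le_antisym)
    qed
  qed
  then show ?thesis unfolding S4MV_I_def by (intro Collect_cong) auto
qed

text \<open>For monotone maps an adjunction amounts to its unit and counit. (GP) is the unit x
  \<preceq> G P x; (HF) at the negation of y is the contrapositive of the counit P G y \<preceq>
  y.\<close>

lemma S4tMV_eq:
  "S4tMV = {A \<in> MV {G, H}. \<forall>\<alpha>\<in>S4_schemes {G, H} \<union> tense_schemes. eq_conseq {A} {} (\<alpha>, One)}"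
proof -
  have "(\<forall>x\<in>car A. \<forall>y\<in>car A. le A x (box A G y) \<longleftrightarrow> le A (past A x) y) \<longleftrightarrow>
      (\<forall>\<alpha>\<in>tense_schemes. eq_conseq {A} {} (\<alpha>, One))" (is "?adj \<longleftrightarrow> _")
    if A: "A \<in> MV {G, H}" for A
  proof -
    interpret mv A using A by (rule MV_mv)
    note car = eval_in_car[OF MV_lang_algebra[OF A]]
    have box [simp]: "box A i x \<in> car A" if "x \<in> car A" for i x
      using A that by (cases i) (simp_all add: MV_def lang_algebra_def)
    have mono: "le A (box A i x) (box A i y)" if "le A x y" "x \<in> car A" "y \<in> car A" for i x y
      using MV_box_mono[OF A, of i x y] that by (cases i) auto
    have past [simp]: "past A x \<in> car A" if "x \<in> car A" for x
      using that by (simp add: past_def)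
    have HF: "le A (neg A y) (box A H (neg A (box A G y))) \<longleftrightarrow> le A (past A (box A G y)) y"
      if "y \<in> car A" for y
      using that by (simp add: past_def neg_le_swap)
    show ?thesis
    proof
      assume adj: ?adj
      have "le A x (box A G (neg A (box A H (neg A x))))" if "x \<in> car A" for x
        using adj that past[OF that] le_refl unfolding past_def by blast
      moreover have "le A (past A (box A G y)) y" if "y \<in> car A" for y
        using adj that box[OF that] le_refl by blast
      \<comment> \<open>The counit at the negation of x, contraposed; the double negation then
        cancels.\<close>
      then have "le A x (box A H (neg A (box A G (neg A x))))" if "x \<in> car A" for x
        using that HF[of "neg A x"] by (simp add: neg_neg)
      ultimately show "\<forall>\<alpha>\<in>tense_schemes. eq_conseq {A} {} (\<alpha>, One)"
        by (auto simp: tense_schemes_def valid_imp_iff[OF A] car neg_def)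
    next
      assume valid: "\<forall>\<alpha>\<in>tense_schemes. eq_conseq {A} {} (\<alpha>, One)"
      have unit: "le A x (box A G (past A x)) \<and> le A x (box A H (neg A (box A G (neg A x))))"
        if "x \<in> car A" for x
      proof -
        have "Var 0 \<^bold>\<rightarrow> Box G (\<^bold>\<not> Box H (\<^bold>\<not> Var 0)) \<in> tense_schemes"
          "Var 0 \<^bold>\<rightarrow> Box H (\<^bold>\<not> Box G (\<^bold>\<not> Var 0)) \<in> tense_schemes"
          by (auto simp: tense_schemes_def)
        then have "eq_conseq {A} {} (Var 0 \<^bold>\<rightarrow> Box G (\<^bold>\<not> Box H (\<^bold>\<not> Var 0)), One)"
          "eq_conseq {A} {} (Var 0 \<^bold>\<rightarrow> Box H (\<^bold>\<not> Box G (\<^bold>\<not> Var 0)), One)" using valid by blast+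
        then show ?thesis using that
          by (auto simp: valid_imp_iff[OF A] past_def neg_def dest!: spec[of _ "\<lambda>_. x"])
      qed
      have counit: "le A (past A (box A G y)) y" if "y \<in> car A" for y
        using unit[of "neg A y"] HF[OF that] that by (simp add: neg_neg)
      have past_mono: "le A (past A x) (past A y)" if "le A x y" "x \<in> car A" "y \<in> car A" for x y
        unfolding past_def using that by (simp add: neg_antimono mono)
      show ?adj
      proof (intro ballI iffI)
        fix x y assume xy: "x \<in> car A" "y \<in> car A" and "le A x (box A G y)"
        then have "le A (past A x) (past A (box A G y))" by (simp add: past_mono)
        then show "le A (past A x) y" using counit[OF xy(2)] xy by (auto intro: le_trans)
      next
        fix x y assume xy: "x \<in> car A" "y \<in> car A" and "le A (past A x) y"
        then have "le A (box A G (past A x)) (box A G y)" by (simp add: mono)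
        then show "le A x (box A G y)" using unit[OF xy(1)] xy by (auto intro: le_trans)
      qed
    qed
  qed
  then show ?thesis unfolding S4tMV_def S4MV_I_eq by (intro Collect_cong) (auto simp: ball_Un)
qed

section \<open>The four logics as instances of the extension theorem\<close>

lemma S4_schemes_Fm: "S4_schemes I \<subseteq> Fm I"
  by (auto simp: S4_schemes_def)

lemma subst_S4_schemes:
  "range \<sigma> \<subseteq> Fm I \<Longrightarrow> \<alpha> \<in> S4_schemes I \<Longrightarrow> subst \<sigma> \<alpha> \<in> S4_schemes I"
  by (auto simp: S4_schemes_def intro: subst_in_Fm)

lemma tense_schemes_Fm: "tense_schemes \<subseteq> Fm {G, H}"
  by (auto simp: tense_schemes_def)

lemma subst_tense_schemes:
  "range \<sigma> \<subseteq> Fm {G, H} \<Longrightarrow> \<alpha> \<in> tense_schemes \<Longrightarrow> subst \<sigma> \<alpha> \<in> tense_schemes"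
  by (auto simp: tense_schemes_def intro: subst_in_Fm)

lemma L_semantics:
  fixes e :: "'i fm \<Rightarrow> 'a"
  assumes "inj_on e (Fm I)"
  shows "equivalent_variety_semantics I (L I) one_eq iff_fm (MV I :: ('i, 'a) alg set)"
  using equivalent_variety_semantics_extension[OF assms, of "{}"] by (simp add: L_def)

lemma S4L_I_semantics:
  fixes e :: "'i fm \<Rightarrow> 'a"
  assumes "inj_on e (Fm I)"
  shows "equivalent_variety_semantics I (S4L_I I) one_eq iff_fm (S4MV_I I :: ('i, 'a) alg set)"
proof -
  have "S4L_axioms I = L_axioms I \<union> S4_schemes I" by (auto simp: S4L_axioms_def S4_schemes_def)
  then show ?thesis
    using equivalent_variety_semantics_extension[OF assms S4_schemes_Fm subst_S4_schemes]
    by (simp add: S4L_I_def S4MV_I_eq)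
qed

lemma S4tL_semantics:
  fixes e :: "tense_conn fm \<Rightarrow> 'a"
  assumes "inj_on e (Fm {G, H})"
  shows "equivalent_variety_semantics {G, H} S4tL one_eq iff_fm (S4tMV :: (tense_conn, 'a) alg set)"
proof -
  have "S4tL_axioms = L_axioms {G, H} \<union> (S4_schemes {G, H} \<union> tense_schemes)"
    by (auto simp: S4tL_axioms_def S4L_axioms_def S4_schemes_def tense_schemes_def)
  moreover have "S4_schemes {G, H} \<union> tense_schemes \<subseteq> Fm {G, H}"
    using S4_schemes_Fm tense_schemes_Fm by blast
  moreover have "subst \<sigma> \<alpha> \<in> S4_schemes {G, H} \<union> tense_schemes"
    if "range \<sigma> \<subseteq> Fm {G, H}" "\<alpha> \<in> S4_schemes {G, H} \<union> tense_schemes" for \<sigma> \<alpha>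
    using that subst_S4_schemes subst_tense_schemes by blast
  ultimately show ?thesis
    using equivalent_variety_semantics_extension[OF assms, of "S4_schemes {G, H} \<union> tense_schemes"]
    unfolding S4tL_def S4tMV_eq by metis
qed

lemma equivalent_variety_semantics_algebraizable:
  fixes K :: "('i, 'a) alg set"
  shows "equivalent_variety_semantics I C \<tau> \<Delta> K \<Longrightarrow> algebraizable TYPE('a) I C \<tau> \<Delta>"
  by (auto simp: equivalent_variety_semantics_def algebraizable_def)

section \<open>Embedding countable languages into the universe\<close>

instance s4_conn :: countable by countable_datatype
instance tense_conn :: countable by countable_datatype
instance fm :: (countable) countable by countable_datatype

text \<open>Already the variables embed the natural numbers into the universe, and a countable set
  of formulas embeds into the natural numbers. This provides room for the languages with connectives
  \<open>Nec\<close> and \<open>G\<close>, \<open>H\<close>.\<close>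

lemma inj_from_countable_fm:
  fixes e :: "'i fm \<Rightarrow> 'a"
  assumes "inj_on e (Fm I)"
  shows "\<exists>e' :: 'j :: countable fm \<Rightarrow> 'a. inj e'"
proof -
  have "inj (\<lambda>\<phi> :: 'j fm. e (Var (to_nat \<phi>)))"
    by (auto intro!: injI dest: inj_onD[OF assms])
  then show ?thesis by blast
qed

(* HOL cannot quantify over all types inside a formula, so the classes of algebras range over
   the algebras with carrier in a universe 'a. The universe is arbitrary, subject only to being
   large enough to contain a copy of the set of formulas of the language. *)
theorem theorem1:
  fixes I :: "'i set" and e :: "'i fm \<Rightarrow> 'a"
  assumes "inj_on e (Fm I)"
  shows
    "(algebraizable TYPE('a) I (L I) one_eq iff_fm \<and>
      algebraizable TYPE('a) I (S4L_I I) one_eq iff_fm \<and>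
      algebraizable TYPE('a) {Nec} S4L one_eq iff_fm \<and>
      algebraizable TYPE('a) {G, H} S4tL one_eq iff_fm) \<and>
     (equivalent_variety_semantics I (L I) one_eq iff_fm (MV I :: ('i, 'a) alg set) \<and>
      equivalent_variety_semantics I (S4L_I I) one_eq iff_fm (S4MV_I I :: ('i, 'a) alg set) \<and>
      equivalent_variety_semantics {Nec} S4L one_eq iff_fm (S4MV :: (s4_conn, 'a) alg set) \<and>
      equivalent_variety_semantics {G, H} S4tL one_eq iff_fm (S4tMV :: (tense_conn, 'a) alg set))"
proof -
  obtain e1 :: "s4_conn fm \<Rightarrow> 'a" and e2 :: "tense_conn fm \<Rightarrow> 'a" where "inj e1" "inj e2"
    using inj_from_countable_fm[OF assms] by metis
  then have e12: "inj_on e1 (Fm {Nec})" "inj_on e2 (Fm {G, H})"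
    by (auto intro: inj_on_subset)
  note sems = L_semantics[OF assms] S4L_I_semantics[OF assms]
    S4L_I_semantics[OF e12(1), folded S4L_def S4MV_def] S4tL_semantics[OF e12(2)]
  show ?thesis
    \<comment> \<open>An equivalent variety semantics is itself a witness of
      algebraizability.\<close>
    by (intro conjI sems sems[THEN equivalent_variety_semantics_algebraizable])
qed

end
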